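(* Let $k\ge1$ be an integer. Then: (i) for every integer $d\ge1$ there is $N$ such that for all $n\ge N$ the Jensen polynomial $J^{d,n-1}(X):=\sum_{j=0}^{d}\binom{d}{j}\Delta_k(n-1+j)X^j$ has only real roots (i.e. $\Delta_k(n)$ satisfies the Turán inequality of order $d$ at $n$); (ii) for every integer $m\ge1$ there is $N$ such that for all $n\ge N$, $$L_m(\Delta_k(n)):=\frac12\sum_{i=0}^{2m}(-1)^{i+m}\binom{2m}{i}\Delta_k(n+i)\Delta_k(n+2m-i)\ge 0.$$
   Context: For an integer $k\ge1$, $\Delta_k(n)$ is defined by $\sum_{n\ge0}\Delta_k(n)q^n=\prod_{m\ge1}\frac{(1-q^{2m})(1-q^{(2k+1)m})}{(1-q^m)^3(1-q^{(4k+2)m})}$. *)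

theory Defs
  imports "HOL-Computational_Algebra.Computational_Algebra"
begin

definition Delta_factor :: "nat \<Rightarrow> nat \<Rightarrow> real fps" where
  "Delta_factor k m =
     (1 - fps_X ^ (2*m)) * (1 - fps_X ^ ((2*k+1)*m)) *
     inverse ((1 - fps_X ^ m) ^ 3 * (1 - fps_X ^ ((4*k+2)*m)))"

text \<open>Coefficient of q^n in the infinite product over m \<ge> 1. Factors with m > n are
  congruent to 1 modulo q^(n+1), so the coefficient of q^n equals that of the
  finite product over 1 \<le> m \<le> n.\<close>
definition Delta :: "nat \<Rightarrow> nat \<Rightarrow> real" where
  "Delta k n = fps_nth (\<Prod>m\<in>{1..n}. Delta_factor k m) n"

definition jensen_poly :: "nat \<Rightarrow> nat \<Rightarrow> nat \<Rightarrow> real poly" where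
  "jensen_poly k d n = (\<Sum>j\<le>d. monom (real (d choose j) * Delta k (n - 1 + j)) j)"

definition only_real_roots :: "real poly \<Rightarrow> bool" where
  "only_real_roots p \<longleftrightarrow> (\<forall>z::complex. poly (map_poly of_real p) z = 0 \<longrightarrow> z \<in> \<real>)"

definition L_op :: "nat \<Rightarrow> nat \<Rightarrow> nat \<Rightarrow> real" where
  "L_op k m n = (1/2) * (\<Sum>i\<le>2*m. (-1) ^ (i + m) * real ((2*m) choose i)
                                     * Delta k (n + i) * Delta k (n + 2*m - i))"

end

theory Submission
  imports Defs "HOL-Complex_Analysis.Complex_Analysis" "HOL-Probability.Probability"
begin

text \<open>
  The generating function is a product of (1 - q^m)^(-w m) over m \<ge> 1 with weights
  w m between 1 and 3. Hence its logarithm has coefficients c N \<ge> 1 for N \<ge> 1, and the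
  moments of c N e^(-N x) have exact order x^(-j-1) as x tends to 0. Put the circle of
  integration at the saddle point x, where the first moment is n, and let s^2 be the second
  moment. Since c N \<ge> 1, the decay of the generating function off the real axis is controlled
  by the geometric series alone, so no modular transformation is needed. After rescaling the
  angle by s, dominated convergence turns the Jensen polynomial of degree d, in the variable
  X = e^(-x) (y/s - 1), into the Gaussian average of (y + iu)^d, which is the Hermite
  polynomial. Its d + 1 points of alternating sign persist and give (i). The values at
  y = 0 are scaled finite differences of the coefficients; the Laguerre expression is
  invariant under passing to these differences, and all terms of its limit are nonnegative, which
  gives (ii).
\<close>

section \<open>Hermite polynomials and real roots\<close>

text \<open>Only orders of magnitude enter. As the moment of index j has order x^(-j-1), s has order
  x^(-3/2). The relevant angles, of size 1/s, are thus smaller than x by a factor x^(1/2), and the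
  cubic Taylor error, the third moment over s^3, has order x^(1/2) and vanishes. No asymptotic
  formula for the coefficients is needed: the normalising factors remain unspecified positive
  sequences, to which both conclusions are insensitive. The obstacle is an integrable bound for all
  angles up to pi. Comparison with the geometric series gives exp(-const t^2/(x(x^2+t^2))), which is
  Gaussian while |t| is at most x and of size exp(-const/x) beyond; the latter beats every power of
  s, while u = st never exceeds pi s. The substitution for X is forced: under Cauchy's integral the
  Jensen sum becomes (1 + X e^x e^(-it))^d, and s(1 + (y/s - 1)e^(-it)) = s(1 - e^(-it)) + y e^(-it)
  tends to y + iu for t = u/s.\<close>

primrec hermite :: "nat \<Rightarrow> real poly" where
  "hermite 0 = 1"
| "hermite (Suc d) = pCons 0 (hermite d) - pderiv (hermite d)"

text \<open>With the probabilists' normalisation, the Gaussian weight turns the recurrence into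
  differentiation: up to sign these are the successive derivatives of exp(-y^2/2).\<close>

definition hermite_fun :: "nat \<Rightarrow> real \<Rightarrow> real" where
  "hermite_fun d y = poly (hermite d) y * exp (- y\<^sup>2 / 2)"

lemma has_real_derivative_hermite_fun:
  "(hermite_fun d has_real_derivative - hermite_fun (Suc d) y) (at y)"
  unfolding hermite_fun_def
  by (auto intro!: derivative_eq_intros simp: algebra_simps)

lemma poly_gauss_at_top: "((\<lambda>y. poly p y * exp (- y\<^sup>2 / 2)) \<longlongrightarrow> (0::real)) at_top"
proof -
  have "((\<lambda>y::real. y ^ k * exp (- y\<^sup>2 / 2)) \<longlongrightarrow> 0) at_top" for k
    by real_asymp
  then have "((\<lambda>y. \<Sum>k\<le>degree p. coeff p k * (y ^ k * exp (- y\<^sup>2 / 2))) \<longlongrightarrow> (\<Sum>k\<le>degree p. coeff p k * 0)) at_top"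
    by (intro tendsto_intros)
  then show ?thesis
    by (simp add: poly_altdef sum_distrib_right mult.assoc)
qed

lemma poly_gauss_at_bot: "((\<lambda>y. poly p y * exp (- y\<^sup>2 / 2)) \<longlongrightarrow> (0::real)) at_bot"
  using poly_gauss_at_top[of "pcompose p [:0, -1:]"]
  by (simp add: filterlim_at_bot_mirror poly_pcompose)

lemma eventually_hermite_fun_small:
  assumes "e > 0"
  shows "\<forall>\<^sub>F y in at_top. \<bar>hermite_fun d y\<bar> < e" "\<forall>\<^sub>F y in at_bot. \<bar>hermite_fun d y\<bar> < e"
  using tendstoD[OF poly_gauss_at_top[of "hermite d"] assms] tendstoD[OF poly_gauss_at_bot[of "hermite d"] assms]
  by (simp_all add: hermite_fun_def)

text \<open>Induction in the style of Rolle. One far point is added on each side of the d + 1 points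
  for index d; on each of the d + 2 intervals so formed, the mean value theorem gives a point where
  minus the derivative, the next function, has the required sign.\<close>

lemma hermite_fun_alternating:
  "\<exists>p. (\<forall>i<d. p i < p (Suc i)) \<and> (\<forall>i\<le>d. 0 < (-1) ^ (d + i) * hermite_fun d (p i))"
proof (induction d)
  case 0
  show ?case by (simp add: hermite_fun_def)
next
  case (Suc d)
  then obtain p where p: "\<And>i. i < d \<Longrightarrow> p i < p (Suc i)"
    and sg: "\<And>i. i \<le> d \<Longrightarrow> 0 < (-1) ^ (d + i) * hermite_fun d (p i)"
    by blast
  have nz: "hermite_fun d (p i) \<noteq> 0" if "i \<le> d" for i
    using sg[OF that] by auto
  \<comment> \<open>A smaller absolute value at \<open>r\<close> than at \<open>p d\<close>
    suffices: the sign of the difference is then the sign at \<open>p d\<close>, whatever the sign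
    at \<open>r\<close>.\<close>
  obtain r where r: "r > p d" "\<bar>hermite_fun d r\<bar> < \<bar>hermite_fun d (p d)\<bar>"
    using eventually_happens'[OF _ eventually_conj[OF eventually_gt_at_top[of "p d"] eventually_hermite_fun_small(1)[of "\<bar>hermite_fun d (p d)\<bar>" d]]]
      nz[of d] by auto
  obtain l where l: "l < p 0" "\<bar>hermite_fun d l\<bar> < \<bar>hermite_fun d (p 0)\<bar>"
    using eventually_happens'[OF _ eventually_conj[OF eventually_gt_at_bot[of "p 0"] eventually_hermite_fun_small(2)[of "\<bar>hermite_fun d (p 0)\<bar>" d]]]
      nz[of 0] by auto
  define q where "q i = (if i = 0 then l else if i \<le> Suc d then p (i - 1) else r)" for i
  have q_less: "q i < q (Suc i)" if "i \<le> Suc d" for i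
    using that l r p[of "i - 1"] by (cases "i = 0"; cases "i = Suc d") (auto simp: q_def)
  have diff: "0 < (-1) ^ (Suc d + i) * (hermite_fun d (q i) - hermite_fun d (q (Suc i)))" if i: "i \<le> Suc d" for i
  proof -
    consider "i = 0" | "0 < i" "i < Suc d" | "0 < i" "i = Suc d" using i by linarith
    then show "0 < (-1) ^ (Suc d + i) * (hermite_fun d (q i) - hermite_fun d (q (Suc i)))"
    proof cases
      case 1
      then show ?thesis using l sg[of 0]
        by (cases "even d") (auto simp: q_def)
    next
      case 2
      then obtain i' where "i = Suc i'" by (auto dest: gr0_implies_Suc)
      then show ?thesis using sg[of i'] sg[of i] 2
        by (cases "even (d + i)") (auto simp: q_def)
    next
      case 3
      then show ?thesis using r sg[of d]
        by (auto simp: q_def)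
    qed
  qed
  have "\<exists>z. q i < z \<and> z < q (Suc i) \<and> 0 < (-1) ^ (Suc d + i) * hermite_fun (Suc d) z" if i: "i \<le> Suc d" for i
  proof -
    obtain z where z: "q i < z" "z < q (Suc i)"
      "hermite_fun d (q (Suc i)) - hermite_fun d (q i) = (q (Suc i) - q i) * - hermite_fun (Suc d) z"
      using MVT2[OF q_less[OF i], of "hermite_fun d" "\<lambda>y. - hermite_fun (Suc d) y"]
        has_real_derivative_hermite_fun by blast
    then have "hermite_fun d (q i) - hermite_fun d (q (Suc i)) = (q (Suc i) - q i) * hermite_fun (Suc d) z"
      by simp
    then have "0 < (-1) ^ (Suc d + i) * ((q (Suc i) - q i) * hermite_fun (Suc d) z)"
      using diff[OF i] by (simp only:)
    then have "0 < (q (Suc i) - q i) * ((-1) ^ (Suc d + i) * hermite_fun (Suc d) z)"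
      by (simp add: mult_ac)
    then have "0 < (-1) ^ (Suc d + i) * hermite_fun (Suc d) z"
      by (rule zero_less_mult_pos) (use q_less[OF i] in simp)
    with z show ?thesis by blast
  qed
  then obtain z where z: "\<And>i. i \<le> Suc d \<Longrightarrow> q i < z i \<and> z i < q (Suc i) \<and> 0 < (-1) ^ (Suc d + i) * hermite_fun (Suc d) (z i)"
    by metis
  show ?case
  proof (intro exI[of _ z] conjI allI impI)
    show "z i < z (Suc i)" if "i < Suc d" for i
      using z[of i] z[of "Suc i"] that by (meson Suc_leI less_imp_le less_trans)
  qed (use z in auto)
qed

lemma hermite_alternating:
  obtains p where "\<And>i. i < d \<Longrightarrow> p i < p (Suc i)"
    and "\<And>i. i \<le> d \<Longrightarrow> 0 < (-1) ^ (d + i) * poly (hermite d) (p i)"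
proof -
  have "0 < (-1) ^ (d + i) * poly (hermite d) y" if "0 < (-1) ^ (d + i) * hermite_fun d y" for i y
    using that unfolding hermite_fun_def mult.assoc[symmetric] by (rule zero_less_mult_pos2) simp
  then show ?thesis
    using hermite_fun_alternating[of d] that by metis
qed

text \<open>Each of the d gaps contains a real root, so there are d distinct ones; as the degree is
  at most d, they exhaust the complex roots.\<close>

lemma only_real_roots_if_alternating:
  fixes P :: "real poly" and p :: "nat \<Rightarrow> real"
  assumes deg: "degree P \<le> d"
    and p: "\<And>i. i < d \<Longrightarrow> p i < p (Suc i)"
    and sg: "\<And>i. i \<le> d \<Longrightarrow> 0 < (-1) ^ (d + i) * poly P (p i)"
  shows "only_real_roots P"
proof -
  have "\<exists>z. p i < z \<and> z < p (Suc i) \<and> poly P z = 0" if "i < d" for i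
    by (rule poly_IVT[OF p[OF that]]) (use sg[of i] sg[of "Suc i"] that in \<open>cases "even (d + i)"; auto simp: mult_less_0_iff\<close>)
  then obtain z where z: "\<And>i. i < d \<Longrightarrow> p i < z i \<and> z i < p (Suc i) \<and> poly P (z i) = 0"
    by metis
  have p_le: "p i \<le> p j" if "i \<le> j" "j \<le> d" for i j
    using that
  proof (induction j)
    case (Suc j)
    then show ?case using p[of j] by (cases "i = Suc j") auto
  qed simp
  have z_less: "z i < z j" if "i < j" "j < d" for i j
    using z[of i] z[of j] p_le[of "Suc i" j] that by auto
  have inj: "inj_on z {..<d}"
    by (rule inj_onI) (metis z_less lessThan_iff less_irrefl linorder_neqE_nat)
  define Q where "Q = map_poly complex_of_real P"
  have "P \<noteq> 0" using sg[of 0] by auto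
  then have Q0: "Q \<noteq> 0" and degQ: "degree Q \<le> d"
    using deg by (auto simp: Q_def map_poly_eq_0_iff degree_map_poly)
  have root: "poly Q (of_real x) = of_real (poly P x)" for x
    by (simp add: Q_def poly_altdef coeff_map_poly degree_map_poly)
  have sub: "of_real ` z ` {..<d} \<subseteq> {x. poly Q x = 0}"
    using z by (auto simp: root)
  have "card (of_real ` z ` {..<d} :: complex set) = d"
    using inj by (simp add: card_image inj_on_def)
  moreover have fin: "finite {x. poly Q x = 0}" and "card {x. poly Q x = 0} \<le> d"
    using card_poly_roots_bound[OF Q0] degQ poly_roots_finite[OF Q0] by linarith+
  ultimately have "of_real ` z ` {..<d} = {x. poly Q x = 0}"
    using sub card_mono[OF fin sub] by (intro card_subset_eq) linarith+
  moreover have "of_real ` z ` {..<d} \<subseteq> (\<real> :: complex set)"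
    by (auto intro: Reals_of_real)
  ultimately show ?thesis
    unfolding only_real_roots_def Q_def[symmetric] by blast
qed

text \<open>Umbral argument: read \<open>r i\<close> as the image of x^i under a linear functional.
  Then \<open>D i\<close> is the image of (1 - x)^i, and both sides arise from applying the
  functional in x and in y to (y - x)^n = ((1 - x) - (1 - y))^n.\<close>

lemma binomial_convolution_difference:
  fixes r :: "nat \<Rightarrow> real"
  defines "D \<equiv> \<lambda>s. \<Sum>j\<le>s. real (s choose j) * (-1) ^ j * r j"
  shows "(\<Sum>i\<le>n. (-1) ^ i * real (n choose i) * r i * r (n - i)) =
         (\<Sum>i\<le>n. (-1) ^ i * real (n choose i) * D i * D (n - i))"
proof -
  define \<Lambda> where "\<Lambda> p = (\<Sum>i\<le>n. coeff p i * r i)" for p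
  have [simp]: "\<Lambda> (smult c p) = c * \<Lambda> p" for c p
    by (simp add: \<Lambda>_def sum_distrib_left mult_ac)
  have L_sum: "\<Lambda> (\<Sum>i\<in>A. f i) = (\<Sum>i\<in>A. \<Lambda> (f i))" for f :: "nat \<Rightarrow> real poly" and A
    unfolding \<Lambda>_def coeff_sum sum_distrib_right by (rule sum.swap)
  have L_monom: "\<Lambda> (monom 1 i) = r i" if "i \<le> n" for i
    using that by (simp add: \<Lambda>_def if_distrib[of "\<lambda>x. x * _"] cong: if_cong)
  have L_pow: "\<Lambda> ([:1, -1:] ^ i) = D i" if "i \<le> n" for i
  proof -
    have "\<Lambda> ([:1, -1:] ^ i) = (\<Sum>j\<le>i. coeff ([:1, -1:] ^ i) j * r j)"
      unfolding \<Lambda>_def using that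
      by (intro sum.mono_neutral_right) (auto intro!: coeff_eq_0 simp: degree_power_eq)
    also have "\<dots> = (\<Sum>j\<le>i. real (i choose j) * (-1) ^ j * r j)"
      by (intro sum.cong refl) (simp add: coeff_linear_poly_power)
    finally show ?thesis by (simp add: D_def)
  qed
  \<comment> \<open>Two expansions of (y - x)^n as polynomials in x for fixed y. Applying
    \<open>\<Lambda>\<close> in x leaves an identity between polynomials in y, to which
    \<open>\<Lambda>\<close> is applied again.\<close>
  have xpoly: "(\<Sum>i\<le>n. smult ((-1) ^ i * real (n choose i) * y ^ (n - i)) (monom 1 i)) =
        (\<Sum>i\<le>n. smult ((-1) ^ i * real (n choose i) * (1 - y) ^ i) ([:1, -1:] ^ (n - i)))" for y
  proof (rule poly_ext)
    fix x
    have "(y - x) ^ n = (\<Sum>i\<le>n. (-1) ^ i * real (n choose i) * y ^ (n - i) * x ^ i)"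
      using binomial_ring[of "- x" y n] by (simp add: mult_ac power_minus[of x] )
    moreover have "(y - x) ^ n = (\<Sum>i\<le>n. (-1) ^ i * real (n choose i) * (1 - y) ^ i * (1 - x) ^ (n - i))"
      using binomial_ring[of "- (1 - y)" "1 - x" n] unfolding power_minus[of "1 - y"]
      by (simp add: mult_ac)
    ultimately show "poly (\<Sum>i\<le>n. smult ((-1) ^ i * real (n choose i) * y ^ (n - i)) (monom 1 i)) x =
        poly (\<Sum>i\<le>n. smult ((-1) ^ i * real (n choose i) * (1 - y) ^ i) ([:1, -1:] ^ (n - i))) x"
      by (simp add: poly_sum poly_monom)
  qed
  have "(\<Sum>i\<le>n. smult ((-1) ^ i * real (n choose i) * r i) (monom 1 (n - i))) =
        (\<Sum>i\<le>n. smult ((-1) ^ i * real (n choose i) * D (n - i)) ([:1, -1:] ^ i))"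
  proof (rule poly_ext)
    fix y
    show "poly (\<Sum>i\<le>n. smult ((-1) ^ i * real (n choose i) * r i) (monom 1 (n - i))) y =
        poly (\<Sum>i\<le>n. smult ((-1) ^ i * real (n choose i) * D (n - i)) ([:1, -1:] ^ i)) y"
      using arg_cong[OF xpoly[of y], of \<Lambda>]
      by (simp add: L_sum L_monom L_pow poly_sum poly_monom mult_ac)
  qed
  from arg_cong[OF this, of \<Lambda>] show ?thesis
    by (simp add: L_sum L_monom L_pow mult_ac)
qed

section \<open>Logarithmic derivatives of Euler products\<close>

text \<open>The relation h = X f'/f without division. The factor X keeps indices aligned: comparing
  coefficients gives N f_N as the convolution of f and h at N.\<close>

definition has_log_deriv :: "'a::field_char_0 fps \<Rightarrow> 'a fps \<Rightarrow> bool" where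
  "has_log_deriv f h \<longleftrightarrow> fps_X * fps_deriv f = f * h"

lemma has_log_deriv_1: "has_log_deriv 1 0"
  by (simp add: has_log_deriv_def)

lemma has_log_deriv_mult:
  assumes "has_log_deriv f h" "has_log_deriv f' h'"
  shows "has_log_deriv (f * f') (h + h')"
proof -
  have "fps_X * fps_deriv (f * f') = f * (fps_X * fps_deriv f') + (fps_X * fps_deriv f) * f'"
    by (simp add: algebra_simps)
  also have "\<dots> = f * f' * (h + h')"
    unfolding assms[unfolded has_log_deriv_def] by (simp add: algebra_simps)
  finally show ?thesis by (simp only: has_log_deriv_def)
qed

lemma has_log_deriv_power: "has_log_deriv f h \<Longrightarrow> has_log_deriv (f ^ n) (of_nat n * h)"
  by (induction n) (auto intro: has_log_deriv_1 dest: has_log_deriv_mult simp: algebra_simps)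

lemma has_log_deriv_prod:
  "(\<And>x. x \<in> A \<Longrightarrow> has_log_deriv (f x) (h x)) \<Longrightarrow> has_log_deriv (\<Prod>x\<in>A. f x) (\<Sum>x\<in>A. h x)"
  by (induction A rule: infinite_finite_induct) (auto intro: has_log_deriv_1 has_log_deriv_mult)

lemma has_log_deriv_inverse:
  assumes "has_log_deriv f h" "fps_nth f 0 \<noteq> 0"
  shows "has_log_deriv (inverse f) (- h)"
proof -
  have "fps_X * fps_deriv (inverse f) = - (fps_X * fps_deriv f) * (inverse f)\<^sup>2"
    using assms(2) by (simp add: fps_inverse_deriv)
  also have "\<dots> = - (f * inverse f) * inverse f * h"
    using assms(1) by (simp add: has_log_deriv_def power2_eq_square)
  finally show ?thesis
    using assms(2) by (simp add: has_log_deriv_def inverse_mult_eq_1')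
qed

text \<open>As h has no constant term, N f_N is determined by earlier coefficients of f, and in
  characteristic zero one can divide by N. Agreement of h and h' up to M is enough, so finite
  truncations of a product can be compared.\<close>

lemma has_log_deriv_unique:
  assumes f: "has_log_deriv f h" "fps_nth f 0 = 1" and f': "has_log_deriv f' h'" "fps_nth f' 0 = 1"
    and h: "\<And>i. i \<le> M \<Longrightarrow> fps_nth h i = fps_nth h' i" "fps_nth h 0 = 0"
  shows "N \<le> M \<Longrightarrow> fps_nth f N = fps_nth f' N"
proof (induction N rule: less_induct)
  case (less N)
  have *: "of_nat N * fps_nth g N = (\<Sum>i=0..N. fps_nth g i * fps_nth u (N - i))"
    if "has_log_deriv g u" for g u :: "'a fps"
  proof -
    have "of_nat N * fps_nth g N = fps_nth (fps_X * fps_deriv g) N"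
      by (cases N) simp_all
    also have "\<dots> = fps_nth (g * u) N"
      using that by (simp only: has_log_deriv_def)
    finally show ?thesis by (simp only: fps_mult_nth)
  qed
  have "of_nat N * fps_nth f N = of_nat N * fps_nth f' N"
    unfolding *[OF f(1)] *[OF f'(1)]
  proof (intro sum.cong refl)
    fix i assume "i \<in> {0..N}"
    then show "fps_nth f i * fps_nth h (N - i) = fps_nth f' i * fps_nth h' (N - i)"
      using less.IH[of i] less.prems h(1)[of "N - i"] h(1)[of 0] h(2)
      by (cases "i = N") auto
  qed
  then show ?case using f(2) f'(2) by (cases "N = 0") auto
qed

text \<open>The series without its sign is the expansion of j X^j/(1 - X^j), whence the exclusion of
  N = 0.\<close>

lemma has_log_deriv_one_minus_X_power:
  assumes "j > 0"
  shows "has_log_deriv (1 - fps_X ^ j)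
    (- Abs_fps (\<lambda>N. if 0 < N \<and> j dvd N then of_nat j else (0::'a::field_char_0)))"
proof -
  let ?g = "Abs_fps (\<lambda>N. if 0 < N \<and> j dvd N then of_nat j else (0::'a))"
  have "(1 - fps_X ^ j) * ?g = of_nat j * fps_X ^ j"
  proof (rule fps_ext)
    fix n
    show "fps_nth ((1 - fps_X ^ j) * ?g) n = fps_nth (of_nat j * fps_X ^ j) n"
      using assms
      by (auto simp: algebra_simps fps_X_power_mult_nth fps_X_power_mult_right_nth fps_mult_of_nat_nth
          dvd_imp_le dvd_minus_self split: if_splits)
  qed
  moreover have "fps_X * fps_deriv (1 - fps_X ^ j) = - (of_nat j * fps_X ^ j :: 'a fps)"
  proof (rule fps_ext)
    fix n
    show "fps_nth (fps_X * fps_deriv (1 - fps_X ^ j)) n = fps_nth (- (of_nat j * fps_X ^ j :: 'a fps)) n"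
      using assms by (cases n) (auto simp: fps_X_power_nth fps_mult_of_nat_nth)
  qed
  ultimately show ?thesis
    by (simp add: has_log_deriv_def)
qed

section \<open>The weights of the product and their divisor sums\<close>

definition weighted_sigma :: "(nat \<Rightarrow> real) \<Rightarrow> nat \<Rightarrow> real" where
  "weighted_sigma w N = (\<Sum>m\<in>{m\<in>{1..N}. m dvd N}. real m * w m)"

text \<open>The exponent of 1/(1 - q^m) once all factors of the product are gathered by their power
  of q.\<close>

definition Delta_weight :: "nat \<Rightarrow> nat \<Rightarrow> real" where
  "Delta_weight k m = 3 - of_bool (2 dvd m) - of_bool ((2*k+1) dvd m) + of_bool ((4*k+2) dvd m)"

text \<open>Reindexes the factors 1 - q^(cm) by the multiples cm themselves; those beyond N cannot
  divide N, so every cutoff M at least N gives the same sum.\<close>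

lemma sum_multiples_dividing:
  assumes "0 < c" "0 < N" "N \<le> M"
  shows "(\<Sum>m=1..M. if c * m dvd N then real (c * m) else 0) =
         (\<Sum>m\<in>{m\<in>{1..N}. m dvd N}. real m * of_bool (c dvd m))"
proof -
  have "(\<Sum>m=1..M. if c * m dvd N then real (c * m) else 0) =
      (\<Sum>m\<in>{m\<in>{1..M}. c * m dvd N}. real (c * m))"
    by (rule sum.inter_filter[symmetric]) simp
  also have "\<dots> = (\<Sum>m\<in>{m\<in>{1..N}. m dvd N \<and> c dvd m}. real m)"
  proof (rule sum.reindex_bij_witness[of _ "\<lambda>m. m div c" "\<lambda>m. c * m"], goal_cases)
    case (2 m)
    then show ?case using assms dvd_imp_le[of "c * m" N] by auto
  next
    case (4 m)
    then obtain m' where "m = c * m'" by auto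
    moreover have "m' \<le> c * m'" using assms by simp
    moreover have "c * m' \<le> N" using 4 \<open>m = c * m'\<close> by auto
    ultimately have "m' \<le> M" "m = c * m'" using assms by linarith+
    then show ?case using 4 assms by auto
  qed (use assms in auto)
  also have "\<dots> = (\<Sum>m\<in>{m\<in>{1..N}. m dvd N}. real m * of_bool (c dvd m))"
    by (rule sum.mono_neutral_cong_left) auto
  finally show ?thesis .
qed

text \<open>Each value of \<open>Delta k\<close> comes from its own finite product. The coefficient
  N of the identity involves only indices up to N, so it can be checked on the single product
  \<open>P N\<close>.\<close>

lemma Delta_log_deriv:
  fixes k
  defines "s \<equiv> weighted_sigma (Delta_weight k)"
  shows "has_log_deriv (Abs_fps (Delta k)) (Abs_fps s)"
proof -
  define g where "g j = Abs_fps (\<lambda>N. if 0 < N \<and> j dvd N then real j else 0)" for j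
  define P where "P M = (\<Prod>m\<in>{1..M}. Delta_factor k m)" for M
  define h where "h M = (\<Sum>m\<in>{1..M}. - g (2 * m) - g ((2*k+1)*m) + (3 * g m + g ((4*k+2)*m)))" for M
  have P: "has_log_deriv (P M) (h M)" for M
    unfolding P_def h_def
  proof (rule has_log_deriv_prod)
    fix m assume "m \<in> {1..M}"
    then have m: "m > 0" by simp
    have g: "has_log_deriv (1 - fps_X ^ j) (- g j)" if "j > 0" for j
      using has_log_deriv_one_minus_X_power[OF that, where 'a = real] by (simp add: g_def)
    have "has_log_deriv (Delta_factor k m)
      ((- g (2*m) + - g ((2*k+1)*m)) + - (of_nat 3 * (- g m) + - g ((4*k+2)*m)))"
      unfolding Delta_factor_def using m
      by (intro has_log_deriv_mult has_log_deriv_inverse has_log_deriv_power g) auto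
    then show "has_log_deriv (Delta_factor k m)
       (- g (2 * m) - g ((2*k+1)*m) + (3 * g m + g ((4*k+2)*m)))"
      by (simp add: algebra_simps)
  qed
  have P0: "fps_nth (P M) 0 = 1" for M
    unfolding P_def by (induction M) (simp_all add: Delta_factor_def fps_power_zeroth)
  have h: "fps_nth (h M) N = s N" if "N \<le> M" for N M
  proof (cases "N = 0")
    case False
    have *: "(\<Sum>m=1..M. fps_nth (g (c * m)) N) =
        (\<Sum>m\<in>{m\<in>{1..N}. m dvd N}. real m * of_bool (c dvd m))" if "c > 0" for c
      using sum_multiples_dividing[of c N M] \<open>N \<le> M\<close> False that by (simp add: g_def)
    have "fps_nth (h M) N = - (\<Sum>m=1..M. fps_nth (g (2 * m)) N) - (\<Sum>m=1..M. fps_nth (g ((2*k+1)*m)) N)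
        + 3 * (\<Sum>m=1..M. fps_nth (g (1 * m)) N) + (\<Sum>m=1..M. fps_nth (g ((4*k+2)*m)) N)"
      by (simp add: h_def fps_sum_nth sum.distrib sum_subtractf sum_distrib_left sum_negf numeral_fps_const)
    also have "\<dots> = s N"
      by (subst (1 2 3 4) *) (simp_all add: s_def weighted_sigma_def Delta_weight_def algebra_simps
        sum.distrib sum_subtractf sum_distrib_left)
    finally show ?thesis .
  qed (simp add: h_def g_def s_def weighted_sigma_def fps_sum_nth numeral_fps_const)
  \<comment> \<open>The logarithmic derivatives of \<open>P N\<close> and \<open>P M\<close> agree
    up to index N, so their coefficients there agree by uniqueness.\<close>
  have Delta: "Delta k N = fps_nth (P M) N" if "N \<le> M" for N M
  proof -
    have "fps_nth (P N) N = fps_nth (P M) N"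
      by (rule has_log_deriv_unique[OF P P0 P P0, of N N M])
        (use that h[of _ N] h[of _ M] in \<open>simp_all add: s_def weighted_sigma_def\<close>)
    then show ?thesis by (simp add: Delta_def P_def)
  qed
  show ?thesis
    unfolding has_log_deriv_def
  proof (rule fps_ext)
    fix N
    have "fps_nth (fps_X * fps_deriv (Abs_fps (Delta k))) N = fps_nth (fps_X * fps_deriv (P N)) N"
      by (cases N) (simp_all add: Delta)
    also have "\<dots> = fps_nth (P N * h N) N"
      using P[of N] by (simp add: has_log_deriv_def)
    also have "\<dots> = fps_nth (Abs_fps (Delta k) * Abs_fps s) N"
      unfolding fps_mult_nth by (intro sum.cong refl) (use Delta h in auto)
    finally show "fps_nth (fps_X * fps_deriv (Abs_fps (Delta k))) N = fps_nth (Abs_fps (Delta k) * Abs_fps s) N" .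
  qed
qed

lemma Delta_0: "Delta k 0 = 1"
  by (simp add: Delta_def)

text \<open>The positive indicator occurs only together with both negative ones, so 3 is never
  exceeded; two negative ones still leave 1.\<close>

lemma Delta_weight_bounds: "1 \<le> Delta_weight k m" "Delta_weight k m \<le> 3"
proof -
  have "4*k+2 = (2*k+1) * 2" by simp
  then have "2 dvd m" "(2*k+1) dvd m" if "(4*k+2) dvd m"
    using that by (metis dvd_mult_left dvd_mult_right)+
  then show "1 \<le> Delta_weight k m" "Delta_weight k m \<le> 3"
    by (auto simp: Delta_weight_def)
qed

section \<open>Moments of the logarithmic coefficients\<close>

lemma power_le_fact_mult_exp:
  fixes x :: real
  assumes "0 \<le> x"
  shows "x ^ k \<le> fact k * exp x"
proof -
  have "(\<Sum>n\<in>{k}. x ^ n /\<^sub>R fact n) \<le> exp x"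
    unfolding exp_def using assms by (intro sum_le_suminf summable_exp_generic) auto
  then show ?thesis by (simp add: field_simps)
qed

lemma sum_exp_neg_le:
  fixes z :: real
  assumes "0 < z"
  shows "(\<Sum>m=1..X. exp (- real m * z)) \<le> 1 / z"
proof -
  define q where "q = exp (- z)"
  have q: "0 < q" "q < 1" using assms by (auto simp: q_def)
  have pw: "exp (- real m * z) = q ^ m" for m
    by (simp add: q_def exp_of_nat_mult[symmetric])
  have "(1 - q) * (\<Sum>m=1..X. q ^ m) = q - q ^ Suc X"
  proof (induction X)
    case (Suc X)
    then show ?case by (simp add: distrib_left) (simp add: algebra_simps)
  qed simp
  then have "(1 - q) * (\<Sum>m=1..X. q ^ m) \<le> q" using q by simp
  moreover have "z * q \<le> 1 - q"
    using exp_ge_add_one_self[of z] q unfolding q_def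
    by (simp add: exp_minus field_simps)
  then have "q \<le> (1 - q) / z" using assms by (simp add: field_simps)
  ultimately have "(1 - q) * (\<Sum>m=1..X. q ^ m) \<le> (1 - q) * (1 / z)" by simp
  then show ?thesis unfolding pw using q by (simp only: mult_le_cancel_left_pos)
qed

lemma sum_inverse_squares_le: "(\<Sum>r=1..X. 1 / (real r)\<^sup>2) \<le> 2"
proof -
  \<comment> \<open>The stronger bound makes the induction work, since 1/(r+1)^2 is at most 1/r -
    1/(r+1).\<close>
  have "(\<Sum>r=1..Suc X. 1 / (real r)\<^sup>2) \<le> 2 - 1 / real (Suc X)" for X
  proof (induction X)
    case (Suc X)
    have "1 / (real (Suc (Suc X)))\<^sup>2 \<le> 1 / real (Suc X) - 1 / real (Suc (Suc X))"
      by (simp add: divide_simps power2_eq_square)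
    with Suc show ?case by simp
  qed simp
  from this[of "X - 1"] show ?thesis
    by (cases X) (auto intro: order_trans)
qed

text \<open>Isolates what the moment estimates use about the product: the upper bound controls size,
  the lower bound 1 forces decay off the real axis.\<close>

locale euler_weight =
  fixes w :: "nat \<Rightarrow> real" and B :: real
  assumes w_ge: "1 \<le> w m" and w_le: "w m \<le> B"
begin

text \<open>Coefficient of q^N in the logarithm of the product over m of (1 - q^m)^(-w m).\<close>

definition c :: "nat \<Rightarrow> real" where
  "c N = weighted_sigma w N / real N"

text \<open>Up to the sign (-1)^j, the j-th derivative in x of the logarithm of the generating
  function at q = e^(-x).\<close>

definition moment :: "nat \<Rightarrow> real \<Rightarrow> real" where
  "moment j x = (\<Sum>N. c N * real N ^ j * exp (- real N * x))"

lemma c_0 [simp]: "c 0 = 0"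
  by (simp add: c_def)

lemma B_ge_1: "1 \<le> B"
  using w_ge w_le order_trans by blast

lemma weighted_sigma_le: "weighted_sigma w N \<le> (\<Sum>m\<in>{m\<in>{1..N}. m dvd N}. B * real m)"
  unfolding weighted_sigma_def using w_le
  by (intro sum_mono) (simp add: mult.commute mult_left_mono)

text \<open>The divisor m = N alone contributes \<open>w N\<close>.\<close>

lemma c_ge_1:
  assumes "0 < N"
  shows "1 \<le> c N"
proof -
  have "real N * 1 \<le> real N * w N" by (intro mult_left_mono w_ge) simp
  also have "\<dots> \<le> weighted_sigma w N"
    unfolding weighted_sigma_def using assms
    by (intro member_le_sum) (auto intro!: mult_nonneg_nonneg order_trans[OF _ w_ge])
  finally show ?thesis using assms by (simp add: c_def field_simps)
qed

lemma c_nonneg: "0 \<le> c N"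
  using c_ge_1[of N] by (cases "N = 0") auto

lemma c_le: "c N \<le> B * real N"
proof -
  have "weighted_sigma w N \<le> (\<Sum>m\<in>{m\<in>{1..N}. m dvd N}. B * real m)"
    by (rule weighted_sigma_le)
  also have "\<dots> \<le> (\<Sum>m\<in>{1..N}. B * real N)"
    using B_ge_1 by (intro order_trans[OF sum_mono2[of "{1..N}"] sum_mono]) auto
  finally show ?thesis by (cases "N = 0") (auto simp: c_def field_simps)
qed

text \<open>Half of the exponential absorbs N^(j+1), where the extra power comes from the crude
  bound on \<open>c N\<close>; the other half leaves a geometric series.\<close>

lemma summable_moment:
  assumes "0 < x"
  shows "summable (\<lambda>N. c N * real N ^ j * exp (- real N * x))"
proof (rule summable_comparison_test')
  define C where "C = B * (fact (Suc j) * (2 / x) ^ Suc j)"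
  show "summable (\<lambda>N. C * exp (- x / 2) ^ N)"
    using assms by (intro summable_mult summable_geometric) auto
  fix N :: nat
  have "real N ^ Suc j = (real N * x / 2) ^ Suc j * (2 / x) ^ Suc j"
    using assms by (simp flip: power_mult_distrib)
  also have "\<dots> \<le> fact (Suc j) * exp (real N * x / 2) * (2 / x) ^ Suc j"
    using assms by (intro mult_right_mono power_le_fact_mult_exp) auto
  finally have pw: "real N ^ Suc j \<le> fact (Suc j) * (2 / x) ^ Suc j * exp (real N * x / 2)"
    by (simp add: mult_ac)
  have "norm (c N * real N ^ j * exp (- real N * x)) = c N * (real N ^ j * exp (- real N * x))"
    using c_nonneg[of N] by (simp add: abs_mult)
  also have "\<dots> \<le> B * real N * (real N ^ j * exp (- real N * x))"
    by (intro mult_right_mono c_le) auto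
  also have "\<dots> = B * (real N ^ Suc j * exp (- real N * x))"
    by simp
  also have "\<dots> \<le> B * (fact (Suc j) * (2 / x) ^ Suc j * exp (real N * x / 2) * exp (- real N * x))"
    using B_ge_1 pw by (intro mult_left_mono mult_right_mono) auto
  also have "exp (real N * x / 2) * exp (- real N * x) = exp (- x / 2) ^ N"
    by (simp flip: exp_add exp_of_nat_mult)
  then have "B * (fact (Suc j) * (2 / x) ^ Suc j * exp (real N * x / 2) * exp (- real N * x)) = C * exp (- x / 2) ^ N"
    by (simp only: C_def mult.assoc)
  finally show "norm (c N * real N ^ j * exp (- real N * x)) \<le> C * exp (- x / 2) ^ N" .
qed

text \<open>The block from X to 2X - 1 with X = ceil(1/x) suffices: it has at least 1/x terms, each
  with N at least 1/x and N x at most 4, because X x is at most 1 + x.\<close>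

lemma moment_ge:
  assumes "0 < x" "x \<le> 1"
  shows "exp (-4) / x ^ Suc j \<le> moment j x"
proof -
  define X where "X = nat \<lceil>1 / x\<rceil>"
  have X1: "1 / x \<le> real X" unfolding X_def by linarith
  have "real X = of_int \<lceil>1 / x\<rceil>" unfolding X_def using assms by simp
  then have "real X \<le> 1 / x + 1" using of_int_ceiling_le_add_one[of "1 / x"] by simp
  then have "real X * x \<le> (1 / x + 1) * x" using assms by (intro mult_right_mono) auto
  then have X2: "real X * x \<le> 2" using assms by (simp add: algebra_simps)
  have X0: "0 < X" using assms X1 by (cases X) (auto simp: divide_le_0_iff)
  have "exp (-4) / x ^ Suc j = 1 / x * ((1 / x) ^ j * exp (-4))"
    by (simp add: power_one_over)
  also have "\<dots> \<le> real X * ((1 / x) ^ j * exp (-4))"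
    using assms X1 by (intro mult_right_mono) auto
  also have "\<dots> = (\<Sum>N\<in>{X..<2*X}. 1 * (1 / x) ^ j * exp (-4))"
    by simp
  also have "\<dots> \<le> (\<Sum>N\<in>{X..<2*X}. c N * real N ^ j * exp (- real N * x))"
  proof (intro sum_mono)
    fix N assume N: "N \<in> {X..<2*X}"
    have "1 / x \<le> real N" using N X1 by auto
    moreover have "real N * x \<le> 2 * real X * x" using N assms by (intro mult_right_mono) auto
    then have "- 4 \<le> - real N * x" using X2 by auto
    ultimately show "1 * (1 / x) ^ j * exp (-4) \<le> c N * real N ^ j * exp (- real N * x)"
      using assms N X0 by (intro mult_mono power_mono c_ge_1) (auto simp: c_nonneg)
  qed
  also have "\<dots> \<le> moment j x"
    unfolding moment_def using assms by (intro sum_le_suminf summable_moment) (auto simp: c_nonneg)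
  finally show ?thesis .
qed

text \<open>Here j! 2^j is the cost of trading y^j for e^y with y = N x/2, the next 2 comes from the
  geometric sum with ratio exp(-r x/2), and the last 2 bounds the sum of 1/r^2.\<close>

definition moment_const :: "nat \<Rightarrow> real" where
  "moment_const j = B * fact j * 2 ^ Suc j * 2"

lemma moment_const_pos: "0 < moment_const j"
  using B_ge_1 by (simp add: moment_const_def)

text \<open>Writing N = m r turns the moment into a double series whose inner sum over m is geometric.\<close>

lemma moment_le:
  assumes "0 < x" "0 < j"
  shows "moment j x \<le> moment_const j / x ^ Suc j"
  unfolding moment_def
proof (rule suminf_le_const[OF summable_moment[OF assms(1)]])
  fix X :: nat
  obtain i where j: "j = Suc i" using assms(2) by (cases j) auto
  define g where "g r m = B * real m * (real m * real r) ^ i * exp (- (real m * real r) * x)" for r m :: nat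
  define S where "S = (SIGMA N:{1..<X}. {m\<in>{1..N}. m dvd N})"
  \<comment> \<open>The pair (N, m) with m dividing N is recovered from (N/m, m), so the divisor
    sums embed into a square of pairs (r, m).\<close>
  define h where "h = (\<lambda>(N::nat, m::nat). (N div m, m))"
  have g_nonneg: "0 \<le> g r m" for r m using B_ge_1 by (simp add: g_def)
  have inj: "inj_on h S"
  proof (rule inj_on_inverseI[where g = "\<lambda>(r, m). (m * r, m)"])
    fix p assume "p \<in> S"
    then obtain N m where "p = (N, m)" "m dvd N" unfolding S_def by blast
    then show "(case h p of (r, m) \<Rightarrow> (m * r, m)) = p" by (simp add: h_def)
  qed
  have hS: "h ` S \<subseteq> {1..X} \<times> {1..X}"
  proof (rule image_subsetI)
    fix p assume "p \<in> S"
    then obtain N m where p: "p = (N, m)" "1 \<le> N" "N < X" "1 \<le> m" "m \<le> N" by (auto simp: S_def)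
    have "N div m \<le> X" using p div_le_dividend[of N m] by linarith
    moreover have "1 \<le> N div m" using p by (simp add: Suc_le_eq div_greater_zero_iff)
    ultimately show "h p \<in> {1..X} \<times> {1..X}" using p by (auto simp: h_def)
  qed
  have "(\<Sum>N<X. c N * real N ^ j * exp (- real N * x)) = (\<Sum>N\<in>{1..<X}. c N * real N ^ j * exp (- real N * x))"
    by (rule sum.mono_neutral_right) (auto simp: not_less_eq_eq)
  \<comment> \<open>One factor of N^j cancels the denominator of \<open>c N\<close>; this is where j
    > 0 enters.\<close>
  also have "\<dots> = (\<Sum>N\<in>{1..<X}. weighted_sigma w N * (real N ^ i * exp (- real N * x)))"
    by (intro sum.cong) (auto simp: c_def j)
  also have "\<dots> \<le> (\<Sum>N\<in>{1..<X}. (\<Sum>m\<in>{m\<in>{1..N}. m dvd N}. B * real m) * (real N ^ i * exp (- real N * x)))"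
    by (intro sum_mono mult_right_mono weighted_sigma_le) auto
  also have "\<dots> = (\<Sum>N\<in>{1..<X}. \<Sum>m\<in>{m\<in>{1..N}. m dvd N}. g (N div m) m)"
    unfolding sum_distrib_right g_def
    by (intro sum.cong refl) (auto simp flip: of_nat_mult simp: mult.assoc)
  also have "\<dots> = (\<Sum>p\<in>S. case h p of (r, m) \<Rightarrow> g r m)"
    unfolding S_def h_def by (subst sum.Sigma) (auto simp: case_prod_unfold)
  also have "\<dots> = (\<Sum>(r, m)\<in>h ` S. g r m)"
    by (simp add: sum.reindex[OF inj] case_prod_unfold)
  also have "\<dots> \<le> (\<Sum>(r, m)\<in>{1..X} \<times> {1..X}. g r m)"
    by (intro sum_mono2 hS) (auto simp: g_nonneg)
  also have "\<dots> = (\<Sum>r=1..X. \<Sum>m=1..X. g r m)"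
    by (rule sum.cartesian_product[symmetric])
  also have "\<dots> \<le> (\<Sum>r=1..X. B * fact j * (2 / x) ^ j * (2 / x) * (1 / (real r)\<^sup>2))"
  proof (rule sum_mono)
    fix r assume "r \<in> {1..X}"
    then have r: "0 < real r" by simp
    have "(\<Sum>m=1..X. g r m) \<le> (\<Sum>m=1..X. B * fact j * (2 / x) ^ j * (1 / real r) * exp (- real m * (real r * x / 2)))"
    proof (rule sum_mono)
      fix m
      \<comment> \<open>Half of the exponent N x with N = m r. Then m N^i = y^j (2/x)^j / r: one
        factor e^(-y) absorbs y^j, the other is summed over m and gives a second factor 1/r.\<close>
      define y where "y = real m * (real r * x / 2)"
      have "g r m = B * (y ^ j * (2 / x) ^ j * (1 / real r)) * (exp (- y) * exp (- y))"
        unfolding g_def y_def j using r assms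
        by (simp add: power_mult_distrib power_divide field_simps flip: exp_add)
      also have "\<dots> \<le> B * ((fact j * exp y) * (2 / x) ^ j * (1 / real r)) * (exp (- y) * exp (- y))"
        using B_ge_1 assms r
        by (intro mult_right_mono mult_left_mono power_le_fact_mult_exp) (auto simp: y_def)
      also have "\<dots> = B * fact j * (2 / x) ^ j * (1 / real r) * exp (- y) * (exp y * exp (- y))"
        by (simp only: mult_ac)
      finally show "g r m \<le> B * fact j * (2 / x) ^ j * (1 / real r) * exp (- real m * (real r * x / 2))"
        by (simp add: y_def flip: exp_add)
    qed
    also have "\<dots> = B * fact j * (2 / x) ^ j * (1 / real r) * (\<Sum>m=1..X. exp (- real m * (real r * x / 2)))"
      by (simp only: sum_distrib_left)
    also have "\<dots> \<le> B * fact j * (2 / x) ^ j * (1 / real r) * (1 / (real r * x / 2))"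
      using assms r B_ge_1 by (intro mult_left_mono sum_exp_neg_le) auto
    also have "\<dots> = B * fact j * (2 / x) ^ j * (2 / x) * (1 / (real r)\<^sup>2)"
      by (simp add: power2_eq_square)
    finally show "(\<Sum>m=1..X. g r m) \<le> B * fact j * (2 / x) ^ j * (2 / x) * (1 / (real r)\<^sup>2)" .
  qed
  also have "\<dots> = B * fact j * (2 / x) ^ j * (2 / x) * (\<Sum>r=1..X. 1 / (real r)\<^sup>2)"
    by (simp only: sum_distrib_left)
  also have "\<dots> \<le> B * fact j * (2 / x) ^ j * (2 / x) * 2"
    using B_ge_1 assms by (intro mult_left_mono sum_inverse_squares_le) auto
  also have "\<dots> = moment_const j / x ^ Suc j"
    by (simp add: moment_const_def power_divide)
  finally show "(\<Sum>N<X. c N * real N ^ j * exp (- real N * x)) \<le> moment_const j / x ^ Suc j" .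
qed

lemma continuous_on_moment: "continuous_on {0<..} (moment j)"
proof (rule continuous_at_imp_continuous_on, intro ballI)
  fix x :: real assume "x \<in> {0<..}"
  then have x: "0 < x" by simp
  have pw: "exp (- real N * y) = exp (- y) ^ N" for N y
    by (simp flip: exp_of_nat_mult)
  have "isCont (\<lambda>y. \<Sum>N. (c N * real N ^ j) * (exp (- y)) ^ N) x"
  proof (rule isCont_powser'[where K = "exp (- (x / 2))"])
    show "summable (\<lambda>N. c N * real N ^ j * exp (- (x / 2)) ^ N)"
      using summable_moment[of "x / 2" j] x unfolding pw by simp
    show "norm (exp (- x)) < norm (exp (- (x / 2)))" using x by simp
  qed simp
  then show "isCont (moment j) x"
    unfolding moment_def pw .
qed

text \<open>The intermediate value theorem solves the saddle equation once n reaches the first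
  moment at 1; for smaller n the value is arbitrary in (0, 1]. The upper moment bound then gives x^2
  = O(1/n).\<close>

lemma saddle_points:
  obtains A :: "nat \<Rightarrow> real" where "\<And>n. 0 < A n" "\<And>n. A n \<le> 1" "A \<longlonglongrightarrow> 0"
    "\<forall>\<^sub>F n in sequentially. moment 1 (A n) = real n"
proof -
  have "\<exists>x. 0 < x \<and> x \<le> 1 \<and> (moment 1 1 \<le> real n \<longrightarrow> moment 1 x = real n)" for n
  proof (cases "moment 1 1 \<le> real n")
    case True
    \<comment> \<open>Chosen so that the lower bound for the first moment at \<open>x0\<close>
      equals n + 1.\<close>
    define x0 where "x0 = sqrt (exp (-4) / (real n + 1))"
    have x0: "0 < x0" "x0 \<le> 1" "x0\<^sup>2 = exp (-4) / (real n + 1)"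
      unfolding x0_def by (auto simp: field_simps) (smt (verit, best) exp_le_one_iff of_nat_0_le_iff)
    have "exp (-4) / x0 ^ Suc 1 \<le> moment 1 x0"
      by (rule moment_ge) (use x0 in auto)
    also have "x0 ^ Suc 1 = x0\<^sup>2" by (simp add: power2_eq_square)
    finally have "real n \<le> moment 1 x0" using x0 by simp
    moreover have "continuous_on {x0..1} (moment 1)"
      by (rule continuous_on_subset[OF continuous_on_moment]) (use x0 in auto)
    ultimately have "\<exists>x. x0 \<le> x \<and> x \<le> 1 \<and> moment 1 x = real n"
      using True x0 by (intro IVT2')
    then show ?thesis using x0 less_le_trans by blast
  qed (auto intro: exI[of _ 1])
  then obtain A where A: "\<And>n. 0 < A n" "\<And>n. A n \<le> 1"
    and eq: "\<And>n. moment 1 1 \<le> real n \<Longrightarrow> moment 1 (A n) = real n"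
    by metis
  have ev: "\<forall>\<^sub>F n in sequentially. moment 1 (A n) = real n"
    using eventually_ge_at_top[of "nat \<lceil>moment 1 1\<rceil>"]
    by eventually_elim (rule eq, linarith)
  have "(\<lambda>n. (A n)\<^sup>2) \<longlonglongrightarrow> 0"
  proof (rule tendsto_sandwich[of "\<lambda>_. 0" _ _ "\<lambda>n. moment_const 1 / real n"])
    show "\<forall>\<^sub>F n in sequentially. (A n)\<^sup>2 \<le> moment_const 1 / real n"
      using ev eventually_gt_at_top[of 0]
    proof eventually_elim
      case (elim n)
      then have "real n \<le> moment_const 1 / (A n)\<^sup>2"
        using moment_le[OF A(1)[of n], of 1] by (simp add: power2_eq_square)
      then show ?case using A(1)[of n] elim by (simp add: field_simps)
    qed
    show "(\<lambda>n. moment_const 1 / real n) \<longlonglongrightarrow> 0"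
      by (rule lim_const_over_n)
  qed auto
  then have "(\<lambda>n. sqrt ((A n)\<^sup>2)) \<longlonglongrightarrow> sqrt 0"
    by (rule tendsto_real_sqrt)
  then have "A \<longlonglongrightarrow> 0"
    using A(1) by (simp add: less_imp_le)
  with A ev that show ?thesis by blast
qed

end

section \<open>Gaussian moments and decay estimates\<close>

text \<open>The expectation of (iZ)^n for a standard normal Z; the factor i supplies the minus sign
  in the recurrence.\<close>

fun gauss_moment :: "nat \<Rightarrow> real" where
  "gauss_moment 0 = 1"
| "gauss_moment (Suc 0) = 0"
| "gauss_moment (Suc (Suc n)) = - real (Suc n) * gauss_moment n"

text \<open>Coefficient form of the identity expressing the Hermite polynomial as the expectation of
  (y + iZ)^d.\<close>

lemma coeff_hermite: "coeff (hermite d) m = real (d choose m) * gauss_moment (d - m)"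
proof (induction d arbitrary: m)
  case 0
  then show ?case by (cases m) auto
next
  case (Suc d)
  show ?case
  proof (cases m)
    case 0
    then show ?thesis
      unfolding hermite.simps coeff_diff coeff_pderiv Suc.IH by (cases d) (simp_all add: algebra_simps)
  next
    case m: (Suc k)
    \<comment> \<open>The derivative term, rewritten by (k+2) C(d,k+2) = (d-k-1) C(d,k+1) and the
      moment recurrence so that Pascal's rule applies. For d = k + 1 the right side vanishes because
      the first moment does.\<close>
    have eq: "real (Suc (Suc k)) * (real (d choose Suc (Suc k)) * gauss_moment (d - Suc (Suc k))) =
        - (real (d choose Suc k) * gauss_moment (d - k))"
    proof (cases "k + 2 \<le> d")
      case True
      then obtain e where d: "d = k + 2 + e" using le_Suc_ex by blast
      define n where "n = k + 1 + e"
      have "Suc (Suc k) * (Suc n choose Suc (Suc k)) = Suc n * (n choose Suc k)"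
        using Suc_times_binomial_eq[of n "Suc k"] by (simp only: mult.commute)
      also have "\<dots> = (Suc n - Suc k) * (Suc n choose Suc k)"
        using binomial_absorb_comp[of "Suc n" "Suc k"] by (simp only: diff_Suc_1)
      also have "Suc n - Suc k = Suc e" by (simp add: n_def)
      also have "Suc n = d" by (simp add: n_def d)
      finally have "real (Suc (Suc k)) * real (d choose Suc (Suc k)) = real (Suc e) * real (d choose Suc k)"
        by (simp only: flip: of_nat_mult)
      then have "real (Suc (Suc k)) * (real (d choose Suc (Suc k)) * gauss_moment e) =
          real (Suc e) * real (d choose Suc k) * gauss_moment e"
        by (simp only: mult.assoc[symmetric])
      then show ?thesis
        by (simp add: d mult_ac del: of_nat_Suc binomial_Suc_Suc)
    next
      case False
      then consider "d = Suc k" | "d \<le> k" by linarith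
      then show ?thesis by cases (simp_all add: binomial_eq_0)
    qed
    show ?thesis
      unfolding m hermite.simps coeff_diff coeff_pCons_Suc coeff_pderiv Suc.IH eq
      by (simp add: algebra_simps)
  qed
qed

lemma gauss_moment_odd: "odd s \<Longrightarrow> gauss_moment s = 0"
  by (induction s rule: gauss_moment.induct) auto

lemma gauss_moment_even: "gauss_moment (2 * k) = (-1) ^ k * (fact (2 * k) / (2 ^ k * fact k))"
proof (induction k)
  case (Suc k)
  have "gauss_moment (2 * Suc k) = - real (2 * k + 1) * ((-1) ^ k * (fact (2 * k) / (2 ^ k * fact k)))"
    using Suc by simp
  also have "\<dots> = (-1) ^ Suc k * (real (2 * k + 1) * (fact (2 * k) / (2 ^ k * fact k)))"
    by (simp only: power_Suc mult_minus_left mult_1_left mult.left_commute[of "(-1) ^ k"])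
  also have "real (2 * k + 1) * (fact (2 * k) / (2 ^ k * fact k)) = fact (2 * Suc k) / (2 ^ Suc k * fact (Suc k))"
    by (simp add: divide_simps)
  finally show ?case .
qed simp

lemma poly_hermite: "poly (hermite d) y = (\<Sum>m\<le>d. real (d choose m) * gauss_moment (d - m) * y ^ m)"
proof -
  have "degree (hermite d) \<le> d"
    by (rule degree_le) (auto simp: coeff_hermite)
  then have "poly (hermite d) y = (\<Sum>m\<le>d. coeff (hermite d) m * y ^ m)"
    unfolding poly_altdef by (intro sum.mono_neutral_left) (auto simp: coeff_eq_0)
  then show ?thesis by (simp only: coeff_hermite)
qed

lemma has_bochner_integral_gauss_moment:
  "has_bochner_integral lborel (\<lambda>u. exp (- u\<^sup>2 / 2) *\<^sub>R (\<i> * of_real u) ^ s)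
     (of_real (sqrt (2 * pi) * gauss_moment s) :: complex)"
proof -
  have real_moment: "has_bochner_integral lborel (\<lambda>u. exp (- u\<^sup>2 / 2) * u ^ s) (sqrt (2 * pi) * r)"
    if "has_bochner_integral lborel (\<lambda>u. std_normal_density u * u ^ s) r" for r
    using has_bochner_integral_mult_right[OF that, of "sqrt (2 * pi)"]
    by (simp add: std_normal_density_def)
  have split: "(\<lambda>u. exp (- u\<^sup>2 / 2) *\<^sub>R (\<i> * of_real u) ^ s) =
      (\<lambda>u. \<i> ^ s * complex_of_real (exp (- u\<^sup>2 / 2) * u ^ s))"
    by (simp add: power_mult_distrib scaleR_conv_of_real mult_ac)
  show ?thesis
  proof (cases "even s")
    case True
    then obtain k where s: "s = 2 * k" by auto
    have "has_bochner_integral lborel (\<lambda>u. exp (- u\<^sup>2 / 2) * u ^ s) (sqrt (2 * pi) * (fact (2 * k) / (2 ^ k * fact k)))"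
      by (rule real_moment) (unfold s, rule std_normal_moment_even)
    from has_bochner_integral_mult_right[OF has_bochner_integral_of_real[OF this], of "\<i> ^ s"]
    have "has_bochner_integral lborel (\<lambda>u. \<i> ^ s * complex_of_real (exp (- u\<^sup>2 / 2) * u ^ s))
        (\<i> ^ s * of_real (sqrt (2 * pi) * (fact (2 * k) / (2 ^ k * fact k))))"
      by blast
    also have "\<i> ^ s * of_real (sqrt (2 * pi) * (fact (2 * k) / (2 ^ k * fact k)))
        = complex_of_real (sqrt (2 * pi) * gauss_moment s)"
      by (simp add: s gauss_moment_even power_mult)
    finally show ?thesis by (simp only: split)
  next
    case False
    then obtain k where s: "s = 2 * k + 1" by (auto elim: oddE)
    have "has_bochner_integral lborel (\<lambda>u. exp (- u\<^sup>2 / 2) * u ^ s) (sqrt (2 * pi) * 0)"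
      by (rule real_moment) (unfold s, rule std_normal_moment_odd)
    from has_bochner_integral_mult_right[OF has_bochner_integral_of_real[OF this], of "\<i> ^ s"]
    show ?thesis
      unfolding split gauss_moment_odd[OF False] by (simp only: mult_zero_right of_real_0)
  qed
qed

lemma has_bochner_integral_hermite:
  "has_bochner_integral lborel (\<lambda>u. exp (- u\<^sup>2 / 2) *\<^sub>R (of_real y + \<i> * of_real u) ^ d)
     (of_real (sqrt (2 * pi) * poly (hermite d) y) :: complex)"
proof -
  have "has_bochner_integral lborel
      (\<lambda>u. \<Sum>m\<le>d. (of_nat (d choose m) * of_real y ^ m) * (exp (- u\<^sup>2 / 2) *\<^sub>R (\<i> * of_real u) ^ (d - m)))
      (\<Sum>m\<le>d. (of_nat (d choose m) * of_real y ^ m) * (of_real (sqrt (2 * pi) * gauss_moment (d - m)) :: complex))"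
    by (intro has_bochner_integral_sum has_bochner_integral_mult_right has_bochner_integral_gauss_moment)
  also have "(\<lambda>u. \<Sum>m\<le>d. (of_nat (d choose m) * of_real y ^ m) * (exp (- u\<^sup>2 / 2) *\<^sub>R (\<i> * of_real u) ^ (d - m)))
      = (\<lambda>u. exp (- u\<^sup>2 / 2) *\<^sub>R (of_real y + \<i> * of_real u) ^ d :: complex)"
    by (simp add: binomial_ring scaleR_conv_of_real sum_distrib_left mult_ac)
  also have "(\<Sum>m\<le>d. (of_nat (d choose m) * of_real y ^ m) * (of_real (sqrt (2 * pi) * gauss_moment (d - m)) :: complex))
      = of_real (sqrt (2 * pi) * poly (hermite d) y)"
    by (simp add: poly_hermite sum_distrib_left mult_ac)
  finally show ?thesis .
qed

section \<open>An integrable majorant and the decay of the geometric series off the real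
  axis\<close>

lemma integrable_inverse_one_plus_square: "integrable lborel (\<lambda>u::real. C / (1 + u\<^sup>2))"
  using integrable_mult_right[OF integrable_inverse_1_plus_square[unfolded set_integrable_def], of C]
  by (simp add: divide_inverse)

text \<open>Use 1 - cos t = 2 sin(t/2)^2 with sin y at least y - y^3/6, hence at least y/3 for y up
  to 2.\<close>

lemma one_minus_cos_ge:
  assumes "\<bar>t\<bar> \<le> pi"
  shows "t\<^sup>2 / 18 \<le> 1 - cos t"
proof -
  define y where "y = \<bar>t\<bar> / 2"
  have y: "0 \<le> y" "y \<le> 2" using assms pi_less_4 by (auto simp: y_def)
  have "\<bar>sin y - y\<bar> \<le> y ^ 3 / 6"
    using Maclaurin_sin_bound[of y 3] y
    by (simp add: eval_nat_numeral sin_coeff_def)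
  moreover have "y ^ 3 \<le> 4 * y"
    using mult_right_mono[OF mult_mono[OF y(2) y(2)], of y] y by (simp add: power3_eq_cube)
  ultimately have "y / 3 \<le> sin y" by linarith
  then have "(y / 3)\<^sup>2 \<le> (sin y)\<^sup>2" using y by (intro power_mono) auto
  moreover have "cos t = 1 - 2 * (sin y)\<^sup>2"
    using cos_double_sin[of y] by (simp add: y_def)
  ultimately show ?thesis by (simp add: y_def power_divide)
qed

text \<open>With E the exponent, \<kappa>/E = x^3 s^2/u^2 + x. The first summand is at most K/u^2;
  as |u| is at most pi s, the second has x^3 at most K pi^2/u^2. Hence 1/E^3 = O(1/u^2), and exp(-E)
  is at most (3p)!/E^(3p).\<close>

lemma exp_neg_quotient_decay:
  fixes K \<kappa> :: real
  assumes "0 < \<kappa>" "0 < K"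
  obtains C where "0 < C"
    "\<And>x s u. 0 < x \<Longrightarrow> 0 < s \<Longrightarrow> x ^ 3 * s\<^sup>2 \<le> K \<Longrightarrow> 1 \<le> \<bar>u\<bar> \<Longrightarrow> \<bar>u\<bar> \<le> pi * s \<Longrightarrow>
       exp (- (\<kappa> * (u / s)\<^sup>2 / (x * (x\<^sup>2 + (u / s)\<^sup>2)))) \<le> C / (u\<^sup>2) ^ p"
proof
  define C1 where "C1 = 4 / \<kappa> ^ 3 * (K ^ 3 + K * pi\<^sup>2)"
  have C1: "0 < C1" unfolding C1_def using assms by (intro mult_pos_pos divide_pos_pos add_pos_pos) auto
  show "0 < fact (3 * p) * C1 ^ p" using C1 by simp
  fix x s u :: real
  assume x: "0 < x" and s: "0 < s" and K: "x ^ 3 * s\<^sup>2 \<le> K" and u: "1 \<le> \<bar>u\<bar>" "\<bar>u\<bar> \<le> pi * s"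
  define E where "E = \<kappa> * (u / s)\<^sup>2 / (x * (x\<^sup>2 + (u / s)\<^sup>2))"
  have u2: "1 \<le> u\<^sup>2" "u \<noteq> 0" using u by (auto simp: abs_le_square_iff[of 1 u, simplified])
  have "0 < (u / s)\<^sup>2" using u2 s by simp
  then have E: "0 < E" using assms x unfolding E_def by (intro divide_pos_pos mult_pos_pos add_pos_pos) auto
  define P where "P = x ^ 3 * s\<^sup>2 / u\<^sup>2"
  have P: "0 \<le> P" "P \<le> K / u\<^sup>2"
    using K x s by (auto simp: P_def intro!: divide_right_mono)
  have "\<kappa> * (1 / E) = P + x"
    using x s u2 assms by (simp add: E_def P_def field_simps eval_nat_numeral)
  then have inv: "1 / E = (P + x) / \<kappa>" using assms by (simp add: field_simps)
  have "P ^ 3 \<le> (K / u\<^sup>2) ^ 3" using P by (intro power_mono)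
  also have "\<dots> = K ^ 3 / u\<^sup>2 / (u\<^sup>2)\<^sup>2" by (simp add: power_divide eval_nat_numeral)
  also have "\<dots> \<le> K ^ 3 / u\<^sup>2 / 1"
    using u2 assms one_le_power[OF u2(1), of 2] by (intro divide_left_mono) auto
  finally have P3: "P ^ 3 \<le> K ^ 3 / u\<^sup>2" by simp
  have "u\<^sup>2 \<le> (pi * s)\<^sup>2" using u(2) by (metis abs_ge_zero power2_abs power_mono)
  then have "x ^ 3 * u\<^sup>2 \<le> x ^ 3 * (pi * s)\<^sup>2" using x by (intro mult_left_mono) auto
  also have "\<dots> = (x ^ 3 * s\<^sup>2) * pi\<^sup>2" by (simp add: power_mult_distrib)
  also have "\<dots> \<le> K * pi\<^sup>2" by (intro mult_right_mono K) auto
  finally have x3: "x ^ 3 \<le> K * pi\<^sup>2 / u\<^sup>2" using u2 by (simp add: field_simps)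
  \<comment> \<open>This is 4(P^3 + x^3) - (P + x)^3 in factored form.\<close>
  have "0 \<le> 3 * (P + x) * (P - x)\<^sup>2" using P x by (intro mult_nonneg_nonneg) auto
  then have "(P + x) ^ 3 \<le> 4 * (P ^ 3 + x ^ 3)"
    by (simp add: algebra_simps eval_nat_numeral)
  also have "\<dots> \<le> 4 * (K ^ 3 / u\<^sup>2 + K * pi\<^sup>2 / u\<^sup>2)" using P3 x3 by simp
  also have "\<dots> = 4 * (K ^ 3 + K * pi\<^sup>2) / u\<^sup>2"
    by (simp add: add_divide_distrib)
  also have "\<dots> = \<kappa> ^ 3 * (C1 / u\<^sup>2)"
    using assms by (simp add: C1_def)
  finally have "(1 / E) ^ 3 \<le> C1 / u\<^sup>2"
    using assms by (simp add: inv power_divide pos_divide_le_eq mult.commute)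
  then have "((1 / E) ^ 3) ^ p \<le> (C1 / u\<^sup>2) ^ p" using E by (intro power_mono) auto
  have "exp (- E) \<le> fact (3 * p) * ((1 / E) ^ 3) ^ p"
    using power_le_fact_mult_exp[of E "3 * p"] E
    by (simp add: exp_minus field_simps flip: power_mult)
  also have "\<dots> \<le> fact (3 * p) * (C1 / u\<^sup>2) ^ p"
    by (intro mult_left_mono) (fact, simp)
  also have "\<dots> = fact (3 * p) * C1 ^ p / (u\<^sup>2) ^ p" by (simp add: power_divide)
  finally show "exp (- (\<kappa> * (u / s)\<^sup>2 / (x * (x\<^sup>2 + (u / s)\<^sup>2)))) \<le> fact (3 * p) * C1 ^ p / (u\<^sup>2) ^ p"
    unfolding E_def .
qed

lemma norm_cis_taylor_le:
  "norm (cis s - 1) \<le> \<bar>s\<bar>"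
  "norm (cis s - 1 - \<i> * of_real s) \<le> s\<^sup>2 / 2"
  "norm (cis s - 1 - \<i> * of_real s + of_real (s\<^sup>2 / 2)) \<le> \<bar>s\<bar> ^ 3 / 6"
  using iexp_approx1[of s 0] iexp_approx1[of s 1] iexp_approx1[of s 2]
  by (simp_all add: cis_conv_exp eval_nat_numeral algebra_simps)

text \<open>With a = 1 - e^(-x) and v = 2 e^(-x)(1 - cos t), the squared modulus of the denominator
  is a^2 + v and the difference is -v(1 - a/2)/(a(a^2 + v)). Since e^(-x) is at least 1/3, v is at
  least t^2/27; 108 is 2 times 54, from 1 - a/2 at least 1/2 and the fraction with t^2/54.\<close>

lemma Re_geometric_le:
  assumes x: "0 < x" "x \<le> 1" and t: "\<bar>t\<bar> \<le> pi"
  shows "Re (1 / (1 - of_real (exp (- x)) * cis t)) - 1 / (1 - exp (- x)) \<le>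
    - (1 / 108 * t\<^sup>2 / (x * (x\<^sup>2 + t\<^sup>2)))"
proof -
  define a where "a = 1 - exp (- x)"
  define v where "v = 2 * exp (- x) * (1 - cos t)"
  have a: "0 < a" "a \<le> 1" using x by (auto simp: a_def)
  have ax: "a \<le> x" using exp_ge_add_one_self[of "- x"] by (simp add: a_def)
  have "exp 1 \<le> (3::real)" using exp_le by simp
  then have "1 / 3 \<le> exp (- (1::real))" by (simp add: exp_minus field_simps)
  also have "\<dots> \<le> exp (- x)" using x by simp
  finally have "1 / 3 \<le> exp (- x)" .
  then have "2 * (1 / 3) * (t\<^sup>2 / 18) \<le> v"
    unfolding v_def using one_minus_cos_ge[OF t] by (intro mult_mono) auto
  then have v: "t\<^sup>2 / 27 \<le> v" "0 \<le> v" using zero_le_power2[of t] by linarith+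
  have "Re (1 / (1 - of_real (exp (- x)) * cis t)) = (1 - exp (- x) * cos t) / ((1 - exp (- x) * cos t)\<^sup>2 + (exp (- x) * sin t)\<^sup>2)"
    by (simp add: Re_divide)
  also have "(1 - exp (- x) * cos t)\<^sup>2 + (exp (- x) * sin t)\<^sup>2 = 1 - 2 * exp (- x) * cos t + (exp (- x))\<^sup>2"
    by (simp add: power_mult_distrib sin_squared_eq power2_diff algebra_simps)
  also have "\<dots> = a\<^sup>2 + v"
    by (simp add: a_def v_def power2_eq_square algebra_simps)
  also have "1 - exp (- x) * cos t = a + v / 2"
    by (simp add: a_def v_def field_simps)
  finally have "Re (1 / (1 - of_real (exp (- x)) * cis t)) - 1 / (1 - exp (- x)) = (a + v / 2) / (a\<^sup>2 + v) - 1 / a"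
    by (simp add: a_def)
  also have "\<dots> = - (v * (1 - a / 2) / (a * (a\<^sup>2 + v)))"
    using a v add_pos_nonneg[of "a\<^sup>2" v] by (simp add: divide_simps) (simp add: power2_eq_square algebra_simps)
  also have "\<dots> \<le> - (1 / 108 * t\<^sup>2 / (x * (x\<^sup>2 + t\<^sup>2)))"
  proof -
    have pos: "0 < a\<^sup>2 + v" "0 < x\<^sup>2 + t\<^sup>2" using a v x by (auto intro: add_pos_nonneg)
    have "1 / 108 * t\<^sup>2 / (x * (x\<^sup>2 + t\<^sup>2)) = (1 / 2) * (1 / x) * ((t\<^sup>2 / 54) / (x\<^sup>2 + t\<^sup>2))"
      by simp
    also have "\<dots> \<le> (1 - a / 2) * (1 / a) * (v / (a\<^sup>2 + v))"
    proof (intro mult_mono)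
      have "t\<^sup>2 / 54 * (a\<^sup>2 + v) \<le> v * (x\<^sup>2 + t\<^sup>2)"
      proof -
        have "a\<^sup>2 \<le> x\<^sup>2" using a ax by (intro power_mono) auto
        then have "t\<^sup>2 / 54 * a\<^sup>2 \<le> v * x\<^sup>2" using v by (intro mult_mono) auto
        moreover have "t\<^sup>2 / 54 * v \<le> t\<^sup>2 * v" using v by (intro mult_right_mono) auto
        ultimately show ?thesis by (simp add: algebra_simps)
      qed
      then have "t\<^sup>2 / 54 \<le> v * (x\<^sup>2 + t\<^sup>2) / (a\<^sup>2 + v)"
        using pos by (simp only: pos_le_divide_eq)
      then show "t\<^sup>2 / 54 / (x\<^sup>2 + t\<^sup>2) \<le> v / (a\<^sup>2 + v)"
        using pos by (simp only: pos_divide_le_eq times_divide_eq_left)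
    qed (use a ax x v pos in \<open>auto simp: divide_left_mono\<close>)
    also have "\<dots> = v * (1 - a / 2) / (a * (a\<^sup>2 + v))" by simp
    finally show ?thesis by simp
  qed
  finally show ?thesis .
qed

section \<open>The generating function on a circle\<close>

text \<open>The sequence enters only through its logarithmic derivative and its initial value, so no
  infinite product has to be evaluated.\<close>

locale euler_product = euler_weight +
  fixes a :: "nat \<Rightarrow> real"
  assumes a_0: "a 0 = 1"
    and log_deriv: "has_log_deriv (Abs_fps a) (Abs_fps (weighted_sigma w))"
begin

definition log_fps :: "complex fps" where
  "log_fps = Abs_fps (\<lambda>N. of_real (c N))"

lemma fps_conv_radius_log_fps: "1 \<le> fps_conv_radius log_fps"
  unfolding fps_conv_radius_def log_fps_def
proof (rule conv_radius_geI_ex')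
  fix r :: real assume r: "0 < r" "ereal r < 1"
  then have "0 < - ln r" by simp
  from summable_moment[OF this, of 0] have "summable (\<lambda>N. c N * r ^ N)"
    using r by (simp add: exp_of_nat_mult)
  then have "summable (\<lambda>N. complex_of_real (c N * r ^ N))"
    by (rule summable_of_real)
  then show "summable (\<lambda>N. fps_nth (Abs_fps (\<lambda>N. complex_of_real (c N))) N * of_real r ^ N)"
    by simp
qed

lemma norm_less_conv_radius: "norm z < 1 \<Longrightarrow> ereal (norm z) < fps_conv_radius log_fps"
  by (rule less_le_trans[OF _ fps_conv_radius_log_fps]) simp

lemma holomorphic_log_fps: "eval_fps log_fps holomorphic_on ball 0 1"
  by (rule holomorphic_on_eval_fps) (simp add: subset_eq norm_less_conv_radius)

text \<open>Both series have constant term 1 and the same logarithmic derivative. This links the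
  formal coefficients to the holomorphic function exp of the logarithmic series.\<close>

lemma exp_log_fps: "fps_nth (fps_compose (fps_exp 1) log_fps) n = of_real (a n)"
proof -
  have deriv: "has_log_deriv (fps_compose (fps_exp 1) log_fps) (fps_X * fps_deriv log_fps)"
    unfolding has_log_deriv_def
    by (subst fps_compose_deriv) (simp_all add: log_fps_def fps_const_mult_left mult_ac)
  have eq: "has_log_deriv (Abs_fps (\<lambda>n. complex_of_real (a n))) (Abs_fps (\<lambda>n. of_real (weighted_sigma w n)))"
    unfolding has_log_deriv_def
  proof (rule fps_ext)
    fix N
    have "real N * a N = fps_nth (fps_X * fps_deriv (Abs_fps a)) N"
      by (cases N) simp_all
    also have "\<dots> = (\<Sum>i=0..N. a i * weighted_sigma w (N - i))"
      using log_deriv by (simp add: has_log_deriv_def fps_mult_nth)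
    finally have *: "real N * a N = (\<Sum>i=0..N. a i * weighted_sigma w (N - i))" .
    have "fps_nth (fps_X * fps_deriv (Abs_fps (\<lambda>n. complex_of_real (a n)))) N = of_real (real N * a N)"
      by (cases N) simp_all
    also have "\<dots> = fps_nth (Abs_fps (\<lambda>n. complex_of_real (a n)) * Abs_fps (\<lambda>n. of_real (weighted_sigma w n))) N"
      unfolding * by (simp add: fps_mult_nth)
    finally show "fps_nth (fps_X * fps_deriv (Abs_fps (\<lambda>n. complex_of_real (a n)))) N =
        fps_nth (Abs_fps (\<lambda>n. complex_of_real (a n)) * Abs_fps (\<lambda>n. of_real (weighted_sigma w n))) N" .
  qed
  have "fps_nth (fps_compose (fps_exp 1) log_fps) n = fps_nth (Abs_fps (\<lambda>n. complex_of_real (a n))) n"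
  proof (rule has_log_deriv_unique[OF deriv _ eq, of n])
    show "fps_nth (fps_X * fps_deriv log_fps) i = fps_nth (Abs_fps (\<lambda>n. of_real (weighted_sigma w n))) i" for i
      by (cases i) (simp_all add: log_fps_def c_def weighted_sigma_def del: of_nat_Suc)
  qed (simp_all add: a_0)
  then show ?thesis by simp
qed

text \<open>The logarithm of the generating function at e^(-x+it); defined by its power series, it
  involves no choice of branch.\<close>

definition log_gf :: "real \<Rightarrow> real \<Rightarrow> complex" where
  "log_gf x t = eval_fps log_fps (of_real (exp (- x)) * cis t)"

lemma log_gf_sums:
  assumes "0 < x"
  shows "(\<lambda>N. of_real (c N * exp (- real N * x)) * cis (real N * t)) sums log_gf x t"
proof -
  have "norm (of_real (exp (- x)) * cis t) < 1"
    using assms by (simp add: norm_mult)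
  then have "(\<lambda>N. fps_nth log_fps N * (of_real (exp (- x)) * cis t) ^ N) sums log_gf x t"
    unfolding log_gf_def by (intro sums_eval_fps norm_less_conv_radius)
  moreover have "exp (- x) ^ N = exp (- real N * x)" for N
    by (simp flip: exp_of_nat_mult)
  then have "fps_nth log_fps N * (of_real (exp (- x)) * cis t) ^ N =
      of_real (c N * exp (- real N * x)) * cis (real N * t)" for N
    by (simp only: power_mult_distrib Complex.DeMoivre log_fps_def fps_nth_Abs_fps of_real_mult
        mult.assoc flip: of_real_power)
  ultimately show ?thesis by simp
qed

lemma log_gf_0:
  assumes "0 < x"
  shows "log_gf x 0 = of_real (moment 0 x)"
proof -
  have "(\<lambda>N. c N * exp (- real N * x)) sums moment 0 x"
    unfolding moment_def using summable_sums[OF summable_moment[OF assms, of 0]] by simp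
  then have "(\<lambda>N. complex_of_real (c N * exp (- real N * x))) sums of_real (moment 0 x)"
    by (simp only: sums_of_real_iff)
  then show ?thesis
    using log_gf_sums[OF assms, of 0] sums_unique2 by simp
qed

lemma continuous_log_gf:
  assumes "0 < x"
  shows "continuous_on UNIV (log_gf x)"
proof -
  have "continuous_on (ball 0 1) (eval_fps log_fps)"
    by (rule holomorphic_on_imp_continuous_on[OF holomorphic_log_fps])
  then show ?thesis
    unfolding log_gf_def
    by (rule continuous_on_compose2[where f = "\<lambda>t. of_real (exp (- x)) * cis t"])
      (use assms in \<open>auto intro!: continuous_intros simp: norm_mult\<close>)
qed

text \<open>Cauchy's formula on the circle of radius e^(-x). The interval is centred at 0, where the
  saddle lies.\<close>

lemma has_integral_coeff:
  assumes "0 < x"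
  shows "((\<lambda>t. exp (log_gf x t) * cis (- t) ^ n) has_integral
    of_real (2 * pi * a n * exp (- real n * x))) {- pi..pi}"
proof -
  define r where "r = exp (- x)"
  have r: "0 < r" "r < 1" using assms by (auto simp: r_def)
  define G where "G z = exp (eval_fps log_fps z)" for z
  define f where "f t = exp (log_gf x t) * cis (- t) ^ n" for t
  have holo: "G holomorphic_on ball 0 1"
    unfolding G_def
    by (rule holomorphic_on_exp'[OF holomorphic_log_fps])
  have "0 < fps_conv_radius log_fps"
    using fps_conv_radius_log_fps by (rule less_le_trans[rotated]) simp
  then have "(exp \<circ> eval_fps log_fps) has_fps_expansion fps_compose (fps_exp 1) log_fps"
    by (intro has_fps_expansion_compose has_fps_expansion_exp1 eval_fps_has_fps_expansion)
      (simp_all add: log_fps_def)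
  then have G: "(deriv ^^ n) G 0 / fact n = of_real (a n)"
    using fps_nth_fps_expansion exp_log_fps by (simp add: G_def[abs_def] o_def)
  have "((\<lambda>u. G u / (u - 0) ^ Suc n) has_contour_integral (2 * pi * \<i>) / fact n * (deriv ^^ n) G 0) (circlepath 0 r)"
    by (rule Cauchy_has_contour_integral_higher_derivative_circlepath)
      (use r in \<open>auto intro!: holomorphic_on_imp_continuous_on holomorphic_on_subset[OF holo]\<close>)
  also have "(2 * pi * \<i>) / fact n * (deriv ^^ n) G 0 = 2 * pi * \<i> * of_real (a n)"
    by (simp flip: G)
  finally have "((\<lambda>t. G (0 + r * cis t) / (0 + r * cis t - 0) ^ Suc n * r * \<i> * cis t) has_integral
      2 * pi * \<i> * of_real (a n)) {0..2 * pi}"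
    unfolding circlepath_def by (subst (asm) has_contour_integral_part_circlepath_iff) auto
  also have "(\<lambda>t. G (0 + r * cis t) / (0 + r * cis t - 0) ^ Suc n * r * \<i> * cis t) =
      (\<lambda>t. \<i> / of_real r ^ n * f t)"
    using r by (auto simp: f_def G_def log_gf_def r_def[symmetric] divide_simps power_mult_distrib
        fun_eq_iff simp flip: cis_inverse power_inverse)
  finally have "((\<lambda>t. of_real r ^ n / \<i> * (\<i> / of_real r ^ n * f t)) has_integral
      of_real r ^ n / \<i> * (2 * pi * \<i> * of_real (a n))) {0..2 * pi}"
    by (rule has_integral_mult_right)
  then have I: "(f has_integral of_real (2 * pi * a n * r ^ n)) {0..2 * pi}"
    using r by (simp add: field_simps)
  have cont: "continuous_on S f" for S
    unfolding f_def
    by (intro continuous_intros continuous_on_subset[OF continuous_log_gf[OF assms]]) auto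
  have per: "f (t + 2 * pi) = f t" for t
  proof -
    have "cis (t + 2 * pi) = cis t" by (simp flip: cis_mult)
    then show ?thesis unfolding f_def log_gf_def cis_cnj[symmetric] by (simp only:)
  qed
  \<comment> \<open>Periodicity moves the half [pi, 2 pi] to [-pi, 0].\<close>
  obtain J1 J2 where J1: "(f has_integral J1) {0..pi}" and J2: "(f has_integral J2) {pi..2 * pi}"
    using integrable_continuous_interval[OF cont] by (meson integrable_on_def)
  have "(f has_integral (J1 + J2)) {0..2 * pi}"
    by (rule has_integral_combine[OF _ _ J1 J2]) auto
  with I have J: "J1 + J2 = of_real (2 * pi * a n * r ^ n)"
    using has_integral_unique by blast
  have "((\<lambda>t. f (t + 2 * pi)) has_integral J2) {pi - 2 * pi..2 * pi - 2 * pi}"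
    using J2 by (rule has_integral_shift_real_ivl)
  then have "(f has_integral J2) {- pi..0}" by (simp add: per)
  then have "(f has_integral (J2 + J1)) {- pi..pi}"
    by (rule has_integral_combine[rotated 2, OF _ J1]) auto
  moreover have "r ^ n = exp (- real n * x)"
    by (simp add: r_def flip: exp_of_nat_mult)
  ultimately show ?thesis
    using J by (simp add: f_def[abs_def] add.commute)
qed

text \<open>Taking real parts makes every term a nonpositive factor cos(Nt) - 1 times
  \<open>c N\<close>, so replacing \<open>c N\<close> by 1 only increases the sum, and a geometric
  series remains.\<close>

lemma norm_exp_log_gf_le:
  assumes x: "0 < x" "x \<le> 1" and t: "\<bar>t\<bar> \<le> pi"
  shows "norm (exp (log_gf x t - log_gf x 0)) \<le> exp (- (1 / 108 * t\<^sup>2 / (x * (x\<^sup>2 + t\<^sup>2))))"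
proof -
  have Re_cis: "Re (of_real b * cis s) = b * cos s" for b s by simp
  have log: "(\<lambda>N. c N * exp (- real N * x) * (cos (real N * t) - 1)) sums Re (log_gf x t - log_gf x 0)"
    using sums_Re[OF sums_diff[OF log_gf_sums[OF x(1), of t] log_gf_sums[OF x(1), of 0]]]
    by (simp add: algebra_simps)
  have pw: "exp (- real N * x) = exp (- x) ^ N" for N
    by (simp flip: exp_of_nat_mult)
  have geo: "(\<lambda>N. of_real (exp (- real N * x)) * cis (real N * s)) sums (1 / (1 - of_real (exp (- x)) * cis s))" for s
  proof -
    have "norm (of_real (exp (- x)) * cis s) < 1" using x by (simp add: norm_mult)
    from geometric_sums[OF this] show ?thesis
      by (simp only: pw power_mult_distrib Complex.DeMoivre of_real_power)
  qed
  have "(\<lambda>N. exp (- real N * x) * (cos (real N * t) - 1)) sums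
      (Re (1 / (1 - of_real (exp (- x)) * cis t)) - Re (1 / (1 - of_real (exp (- x)) * cis 0)))"
    using sums_Re[OF sums_diff[OF geo[of t] geo[of 0]]] by (simp add: algebra_simps)
  also have "Re (1 / (1 - of_real (exp (- x)) * cis 0)) = 1 / (1 - exp (- x))"
    by (simp add: Re_divide power2_eq_square)
  finally have geo': "(\<lambda>N. exp (- real N * x) * (cos (real N * t) - 1)) sums
      (Re (1 / (1 - of_real (exp (- x)) * cis t)) - 1 / (1 - exp (- x)))" .
  have "Re (log_gf x t - log_gf x 0) \<le> Re (1 / (1 - of_real (exp (- x)) * cis t)) - 1 / (1 - exp (- x))"
  proof (rule sums_le[OF _ log geo'])
    fix N
    show "c N * exp (- real N * x) * (cos (real N * t) - 1) \<le> exp (- real N * x) * (cos (real N * t) - 1)"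
    \<comment> \<open>At N = 0 the coefficient is 0 and not at least 1, but cos(Nt) - 1 vanishes
      there.\<close>
    proof (cases "N = 0")
      case False
      have "c N * (exp (- real N * x) * (cos (real N * t) - 1)) \<le> 1 * (exp (- real N * x) * (cos (real N * t) - 1))"
        using c_ge_1[of N] False by (intro mult_right_mono_neg) (auto simp: mult_le_0_iff)
      then show ?thesis by (simp add: mult.assoc)
    qed simp
  qed
  also have "\<dots> \<le> - (1 / 108 * t\<^sup>2 / (x * (x\<^sup>2 + t\<^sup>2)))"
    by (rule Re_geometric_le) (use x t in auto)
  finally show ?thesis by simp
qed

lemma norm_log_gf_taylor_le:
  assumes x: "0 < x"
  shows "norm (log_gf x t - log_gf x 0 - \<i> * of_real (t * moment 1 x) + of_real (t\<^sup>2 / 2 * moment 2 x))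
    \<le> moment 3 x * \<bar>t\<bar> ^ 3 / 6"
proof -
  have moment: "(\<lambda>N. c N * real N ^ j * exp (- real N * x)) sums moment j x" for j
    unfolding moment_def by (intro summable_sums summable_moment x)
  have moment': "(\<lambda>N. z * complex_of_real (b * (c N * real N ^ j * exp (- real N * x)))) sums (z * of_real (b * moment j x))" for z b j
    by (intro sums_mult) (unfold sums_of_real_iff, intro sums_mult moment)
  define f where "f N = of_real (c N * exp (- real N * x)) *
     (cis (real N * t) - 1 - \<i> * of_real (real N * t) + of_real ((real N * t)\<^sup>2 / 2))" for N
  have "f sums (log_gf x t - log_gf x 0 - \<i> * of_real (t * moment 1 x) + 1 * of_real (t\<^sup>2 / 2 * moment 2 x))"
    using sums_add[OF sums_diff[OF sums_diff[OF log_gf_sums[OF x, of t] log_gf_sums[OF x, of 0]]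
       moment'[of \<i> t 1]] moment'[of 1 "t\<^sup>2 / 2" 2]]
    by (rule sums_cong[THEN iffD1, rotated]) (simp add: f_def algebra_simps power_mult_distrib)
  moreover have "(\<lambda>N. c N * real N ^ 3 * exp (- real N * x) * (\<bar>t\<bar> ^ 3 / 6)) sums (moment 3 x * (\<bar>t\<bar> ^ 3 / 6))"
    by (intro sums_mult2 moment)
  moreover have "norm (f N) \<le> c N * real N ^ 3 * exp (- real N * x) * (\<bar>t\<bar> ^ 3 / 6)" for N
  proof -
    have "norm (f N) = c N * exp (- real N * x) *
        norm (cis (real N * t) - 1 - \<i> * of_real (real N * t) + of_real ((real N * t)\<^sup>2 / 2))"
      using c_nonneg[of N] by (simp only: f_def norm_mult norm_of_real abs_mult abs_of_nonneg abs_exp_cancel)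
    also have "\<dots> \<le> c N * exp (- real N * x) * (\<bar>real N * t\<bar> ^ 3 / 6)"
      using c_nonneg[of N] by (intro mult_left_mono norm_cis_taylor_le) auto
    also have "\<dots> = c N * real N ^ 3 * exp (- real N * x) * (\<bar>t\<bar> ^ 3 / 6)"
      by (simp add: abs_mult power_mult_distrib)
    finally show ?thesis .
  qed
  ultimately show ?thesis
    using norm_suminf_le[of f "\<lambda>N. c N * real N ^ 3 * exp (- real N * x) * (\<bar>t\<bar> ^ 3 / 6)"]
    by (simp add: sums_iff)
qed

end

subsection \<open>The saddle point limit\<close>

context euler_product
begin

text \<open>The standard deviation of the distribution proportional to a(n) e^(-nx), whose mean is
  \<open>moment 1 x\<close>.\<close>

definition sdev :: "real \<Rightarrow> real" where
  "sdev x = sqrt (moment 2 x)"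

lemma sdev_bounds:
  assumes "0 < x" "x \<le> 1"
  shows "0 < sdev x" "(sdev x)\<^sup>2 = moment 2 x" "x ^ 3 * (sdev x)\<^sup>2 \<le> moment_const 2"
    "1 / (sdev x)\<^sup>2 \<le> exp 4 * x ^ 3"
proof -
  have lower: "exp (- 4) / x ^ 3 \<le> moment 2 x"
    using moment_ge[OF assms, of 2] by (simp add: eval_nat_numeral)
  moreover have "0 < exp (- 4) / x ^ 3" using assms by simp
  ultimately have pos: "0 < moment 2 x" by linarith
  then show "0 < sdev x" and sq: "(sdev x)\<^sup>2 = moment 2 x" by (auto simp: sdev_def)
  show "x ^ 3 * (sdev x)\<^sup>2 \<le> moment_const 2"
    using moment_le[OF assms(1), of 2] assms unfolding sq by (simp add: eval_nat_numeral field_simps)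
  have "exp (- 4) \<le> moment 2 x * x ^ 3"
    using lower assms by (simp add: pos_divide_le_eq)
  then show "1 / (sdev x)\<^sup>2 \<le> exp 4 * x ^ 3"
    using pos unfolding sq by (simp add: pos_divide_le_eq exp_minus field_simps)
qed

text \<open>The last factor is s^d (1 + (y/s - 1) e^(-it))^d, with the large s moved inside so that
  the limit at t = u/s is visible.\<close>

definition integrand :: "real \<Rightarrow> nat \<Rightarrow> nat \<Rightarrow> real \<Rightarrow> real \<Rightarrow> complex" where
  "integrand x n d y t = exp (log_gf x t - log_gf x 0) * cis (- t) ^ n *
     (of_real (sdev x) * (1 - cis (- t)) + of_real y * cis (- t)) ^ d"

text \<open>Extended by zero beyond |t| = pi, all integrals are over the whole line, as dominated
  convergence requires.\<close>

definition kernel :: "real \<Rightarrow> nat \<Rightarrow> nat \<Rightarrow> real \<Rightarrow> real \<Rightarrow> complex" where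
  "kernel x n d y u = indicator {- pi..pi} (u / sdev x) *\<^sub>R integrand x n d y (u / sdev x)"

text \<open>Cauchy's integral for the coefficient n + j, stripped of e^(-jx) and divided by the
  value of the generating function at the saddle, whose logarithm is
  \<open>moment 0 x\<close>.\<close>

definition scaled_coeff :: "real \<Rightarrow> nat \<Rightarrow> nat \<Rightarrow> real" where
  "scaled_coeff x n j = 2 * pi * exp (- real n * x - moment 0 x) * (a (n + j) * exp (- x) ^ j)"

lemma continuous_integrand: "0 < x \<Longrightarrow> continuous_on S (integrand x n d y)"
  unfolding integrand_def
  by (intro continuous_intros continuous_on_subset[OF continuous_log_gf]) auto

lemma has_integral_integrand:
  assumes "0 < x" "x \<le> 1"
  shows "(integrand x n d y has_integral
    of_real (sdev x ^ d * (\<Sum>j\<le>d. real (d choose j) * (y / sdev x - 1) ^ j * scaled_coeff x n j))) {- pi..pi}"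
proof -
  define s where "s = sdev x"
  have s: "0 < s" using sdev_bounds[OF assms] by (simp add: s_def)
  define k where "k j = of_real (s ^ d * (real (d choose j) * (y / s - 1) ^ j)) * exp (- log_gf x 0)" for j
  have "((\<lambda>t. \<Sum>j\<le>d. k j * (exp (log_gf x t) * cis (- t) ^ (n + j))) has_integral
      (\<Sum>j\<le>d. k j * of_real (2 * pi * a (n + j) * exp (- real (n + j) * x)))) {- pi..pi}"
    by (intro has_integral_sum has_integral_mult_right has_integral_coeff assms) simp
  also have "(\<lambda>t. \<Sum>j\<le>d. k j * (exp (log_gf x t) * cis (- t) ^ (n + j))) = integrand x n d y"
  proof
    fix t
    define z where "z = cis (- t)"
    have "of_real s * (1 - z) + of_real y * z = of_real s * (of_real (y / s - 1) * z + 1)"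
      using s by (simp add: algebra_simps)
    then have "(of_real s * (1 - z) + of_real y * z) ^ d =
        of_real s ^ d * (\<Sum>j\<le>d. of_nat (d choose j) * (of_real (y / s - 1) * z) ^ j * 1 ^ (d - j))"
      by (simp only: power_mult_distrib binomial_ring)
    then show "(\<Sum>j\<le>d. k j * (exp (log_gf x t) * cis (- t) ^ (n + j))) = integrand x n d y t"
      unfolding integrand_def s_def[symmetric] z_def[symmetric]
      by (simp add: k_def exp_diff exp_minus divide_inverse sum_distrib_left sum_distrib_right power_mult_distrib power_add mult_ac)
  qed
  also have "(\<Sum>j\<le>d. k j * of_real (2 * pi * a (n + j) * exp (- real (n + j) * x))) =
      (\<Sum>j\<le>d. of_real (s ^ d * (real (d choose j) * (y / s - 1) ^ j * scaled_coeff x n j)))"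
  proof (intro sum.cong refl)
    fix j
    have "exp (- log_gf x 0) = of_real (exp (- moment 0 x))"
      by (simp add: log_gf_0[OF assms(1)] exp_of_real flip: of_real_minus)
    moreover have "exp (- real (n + j) * x) = exp (- real n * x) * exp (- x) ^ j"
      by (simp add: algebra_simps flip: exp_of_nat_mult exp_add)
    ultimately show "k j * of_real (2 * pi * a (n + j) * exp (- real (n + j) * x)) =
        of_real (s ^ d * (real (d choose j) * (y / s - 1) ^ j * scaled_coeff x n j))"
      unfolding k_def scaled_coeff_def
      by (simp only: of_real_mult[symmetric] exp_diff exp_minus divide_inverse mult_ac)
  qed
  finally show ?thesis
    by (simp only: s_def sum_distrib_left of_real_sum)
qed

text \<open>Of the d + 1 factors s, one is the Jacobian of u = st.\<close>

lemma integral_kernel: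
  assumes "0 < x" "x \<le> 1"
  shows "integral\<^sup>L lborel (kernel x n d y) =
    of_real (sdev x ^ Suc d * (\<Sum>j\<le>d. real (d choose j) * (y / sdev x - 1) ^ j * scaled_coeff x n j))"
proof -
  define s where "s = sdev x"
  have s: "0 < s" using sdev_bounds[OF assms] by (simp add: s_def)
  define F where "F t = indicator {- pi..pi} t *\<^sub>R integrand x n d y t" for t
  have "integral\<^sup>L lborel F = integral {- pi..pi} (integrand x n d y)"
    using set_borel_integral_eq_integral(2)[OF borel_integrable_atLeastAtMost'[OF continuous_integrand[OF assms(1)]]]
    by (simp add: set_lebesgue_integral_def F_def[abs_def])
  also have "\<dots> = of_real (s ^ d * (\<Sum>j\<le>d. real (d choose j) * (y / s - 1) ^ j * scaled_coeff x n j))"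
    unfolding s_def by (rule integral_unique[OF has_integral_integrand[OF assms]])
  finally have F: "integral\<^sup>L lborel F = \<dots>" .
  have "integral\<^sup>L lborel F = (1 / s) *\<^sub>R (\<integral>u. F (0 + (1 / s) * u) \<partial>lborel)"
    using lborel_integral_real_affine[of "1 / s" F 0] s by simp
  also have "(\<lambda>u. F (0 + (1 / s) * u)) = kernel x n d y"
    by (simp add: F_def kernel_def s_def fun_eq_iff)
  finally have "integral\<^sup>L lborel (kernel x n d y) = s *\<^sub>R integral\<^sup>L lborel F"
    using s by simp
  then show ?thesis
    unfolding F by (simp add: s_def scaleR_conv_of_real mult.assoc)
qed

lemma measurable_kernel [measurable]:
  assumes "0 < x"
  shows "kernel x n d y \<in> borel_measurable lborel"
proof -
  have [measurable]: "integrand x n d y \<in> borel_measurable borel"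
    by (rule borel_measurable_continuous_onI[OF continuous_integrand[OF assms]])
  show ?thesis unfolding kernel_def by measurable
qed

text \<open>The polynomial factor is at most (|u| + |y|)^d, because |1 - e^(-it)| is at most |t|.
  For |u| > 1 the decay lemma with exponent d + 1 outweighs it and leaves 1/u^2; for |u| at most 1 a
  constant suffices. The index n only enters through a factor of modulus 1.\<close>

lemma kernel_bound:
  obtains C where "\<And>x n u. 0 < x \<Longrightarrow> x \<le> 1 \<Longrightarrow> norm (kernel x n d y u) \<le> C / (1 + u\<^sup>2)"
proof -
  obtain C where C: "0 < C"
    "\<And>x s u. 0 < x \<Longrightarrow> 0 < s \<Longrightarrow> x ^ 3 * s\<^sup>2 \<le> moment_const 2 \<Longrightarrow> 1 \<le> \<bar>u\<bar> \<Longrightarrow> \<bar>u\<bar> \<le> pi * s \<Longrightarrow>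
       exp (- (1 / 108 * (u / s)\<^sup>2 / (x * (x\<^sup>2 + (u / s)\<^sup>2)))) \<le> C / (u\<^sup>2) ^ Suc d"
    using exp_neg_quotient_decay[of "1 / 108" "moment_const 2" "Suc d"] moment_const_pos by auto
  define Y where "Y = (1 + \<bar>y\<bar>) ^ d"
  have Y: "0 \<le> Y" by (simp add: Y_def)
  show thesis
  proof (rule that)
    fix x n u assume x: "0 < x" "x \<le> (1::real)"
    define s where "s = sdev x"
    have s: "0 < s" "x ^ 3 * s\<^sup>2 \<le> moment_const 2" using sdev_bounds[OF x] by (auto simp: s_def)
    have rhs: "0 \<le> 2 * Y * (1 + C) / (1 + u\<^sup>2)"
      using Y C(1) by (intro divide_nonneg_pos mult_nonneg_nonneg add_pos_nonneg) auto
    show "norm (kernel x n d y u) \<le> 2 * Y * (1 + C) / (1 + u\<^sup>2)"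
    proof (cases "\<bar>u / s\<bar> \<le> pi")
      case False
      then have "u / s \<notin> {- pi..pi}" by auto
      then show ?thesis using rhs by (simp add: kernel_def s_def)
    next
      case t: True
      define E where "E = 1 / 108 * (u / s)\<^sup>2 / (x * (x\<^sup>2 + (u / s)\<^sup>2))"
      have "norm (of_real s * (1 - cis (- (u / s))) + of_real y * cis (- (u / s))) \<le>
          s * norm (cis (- (u / s)) - 1) + \<bar>y\<bar>"
        using s by (intro order_trans[OF norm_triangle_ineq]) (simp add: norm_mult norm_minus_commute)
      also have "\<dots> \<le> s * \<bar>- (u / s)\<bar> + \<bar>y\<bar>"
        using s by (intro add_right_mono mult_left_mono norm_cis_taylor_le) auto
      also have "\<dots> = \<bar>u\<bar> + \<bar>y\<bar>" using s by simp
      finally have base: "norm (of_real s * (1 - cis (- (u / s))) + of_real y * cis (- (u / s))) \<le> \<bar>u\<bar> + \<bar>y\<bar>" .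
      have "norm (kernel x n d y u) \<le> norm (exp (log_gf x (u / s) - log_gf x 0)) *
          norm (of_real s * (1 - cis (- (u / s))) + of_real y * cis (- (u / s))) ^ d"
        by (simp add: kernel_def integrand_def s_def norm_mult norm_power indicator_def)
      also have "\<dots> \<le> exp (- E) * (\<bar>u\<bar> + \<bar>y\<bar>) ^ d"
        unfolding E_def using norm_exp_log_gf_le[OF x t] base by (intro mult_mono power_mono) auto
      finally have bound: "norm (kernel x n d y u) \<le> exp (- E) * (\<bar>u\<bar> + \<bar>y\<bar>) ^ d" .
      show ?thesis
      proof (cases "\<bar>u\<bar> \<le> 1")
        case True
        have "0 \<le> E" using x by (auto simp: E_def)
        then have "exp (- E) * (\<bar>u\<bar> + \<bar>y\<bar>) ^ d \<le> 1 * Y"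
          unfolding Y_def using True by (intro mult_mono power_mono) auto
        also have "\<dots> \<le> 2 * Y * (1 + C) / (1 + u\<^sup>2)"
        proof -
          have "u\<^sup>2 \<le> 1" using True by (simp add: abs_square_le_1)
          then have "Y * (1 + u\<^sup>2) \<le> Y * (2 * (1 + C))" using Y C(1) by (intro mult_left_mono) auto
          then show ?thesis by (simp add: pos_le_divide_eq add_pos_nonneg mult_ac)
        qed
        finally show ?thesis using bound by linarith
      next
        case False
        then have u: "1 \<le> \<bar>u\<bar>" by simp
        have u2: "1 \<le> u\<^sup>2" using u by (simp add: abs_le_square_iff[of 1 u, simplified])
        have "\<bar>u\<bar> \<le> pi * s" using t s by (simp add: abs_divide pos_divide_le_eq)
        then have "exp (- E) \<le> C / (u\<^sup>2) ^ Suc d"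
          unfolding E_def using x s u by (intro C(2))
        moreover have "\<bar>u\<bar> + \<bar>y\<bar> \<le> u\<^sup>2 * (1 + \<bar>y\<bar>)"
        proof -
          have "\<bar>u\<bar> * 1 \<le> \<bar>u\<bar> * \<bar>u\<bar>" using u by (intro mult_left_mono) auto
          then have "\<bar>u\<bar> \<le> u\<^sup>2" by (simp add: power2_eq_square)
          moreover have "1 * \<bar>y\<bar> \<le> u\<^sup>2 * \<bar>y\<bar>" using u2 by (intro mult_right_mono) auto
          ultimately show ?thesis by (simp add: algebra_simps)
        qed
        then have "(\<bar>u\<bar> + \<bar>y\<bar>) ^ d \<le> (u\<^sup>2 * (1 + \<bar>y\<bar>)) ^ d" by (intro power_mono) auto
        ultimately have "exp (- E) * (\<bar>u\<bar> + \<bar>y\<bar>) ^ d \<le> C / (u\<^sup>2) ^ Suc d * (u\<^sup>2 * (1 + \<bar>y\<bar>)) ^ d"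
          using C(1) by (intro mult_mono) auto
        also have "\<dots> = C * Y / u\<^sup>2"
          using u2 by (auto simp: Y_def power_mult_distrib)
        also have "\<dots> \<le> 2 * Y * (1 + C) / (1 + u\<^sup>2)"
        proof -
          have "C * Y * (1 + u\<^sup>2) \<le> (1 + C) * Y * (2 * u\<^sup>2)"
            using u2 Y C(1) by (intro mult_mono) auto
          then have "C * Y * (1 + u\<^sup>2) \<le> 2 * Y * (1 + C) * u\<^sup>2" by (simp only: mult_ac)
          moreover have "0 < u\<^sup>2" "0 < 1 + u\<^sup>2" using u2 by linarith+
          ultimately show ?thesis by (simp only: pos_le_divide_eq pos_divide_le_eq times_divide_eq_left)
        qed
        finally show ?thesis using bound by linarith
      qed
    qed
  qed
qed

text \<open>At the saddle the phase e^(-int) cancels the linear Taylor term of the logarithm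
  exactly, and the quadratic term is -u^2/2 since t^2 times the second moment is u^2.\<close>

lemma kernel_tendsto:
  assumes A: "\<And>n. 0 < A n" "\<And>n. A n \<le> 1" "A \<longlonglongrightarrow> 0"
    and saddle: "\<forall>\<^sub>F n in sequentially. moment 1 (A n) = real n"
  shows "(\<lambda>n. kernel (A n) n d y u) \<longlonglongrightarrow> exp (- u\<^sup>2 / 2) *\<^sub>R (of_real y + \<i> * of_real u) ^ d"
proof -
  define s where "s n = sdev (A n)" for n
  define t where "t n = u / s n" for n
  have s: "0 < s n" "(s n)\<^sup>2 = moment 2 (A n)" "1 / (s n)\<^sup>2 \<le> exp 4 * A n ^ 3" for n
    using sdev_bounds[OF A(1,2)[of n]] by (auto simp: s_def)
  have st: "s n * t n = u" for n using s(1)[of n] by (simp add: t_def)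
  have "(\<lambda>n. 1 / (s n)\<^sup>2) \<longlonglongrightarrow> 0"
  proof (rule tendsto_sandwich[of "\<lambda>_. 0"])
    show "(\<lambda>n. exp 4 * A n ^ 3) \<longlonglongrightarrow> 0"
      by (rule tendsto_eq_intros A(3) | simp)+
    show "\<forall>\<^sub>F n in sequentially. 1 / (s n)\<^sup>2 \<le> exp 4 * A n ^ 3"
      by (intro always_eventually allI s(3))
  qed simp_all
  then have "(\<lambda>n. sqrt (1 / (s n)\<^sup>2)) \<longlonglongrightarrow> sqrt 0"
    by (rule tendsto_real_sqrt)
  then have inv_s: "(\<lambda>n. 1 / s n) \<longlonglongrightarrow> 0"
    using s(1) by (simp add: real_sqrt_divide less_imp_le)
  have t0: "t \<longlonglongrightarrow> 0"
    using tendsto_mult[OF tendsto_const[of u] inv_s] by (simp add: t_def[abs_def])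
  have cis_t: "(\<lambda>n. cis (- t n)) \<longlonglongrightarrow> 1"
    using tendsto_cis[OF tendsto_minus[OF t0]] by simp

  have linear: "(\<lambda>n. of_real (s n) * (1 - cis (- t n))) \<longlonglongrightarrow> \<i> * of_real u"
  proof (rule LIM_zero_cancel, rule Lim_null_comparison)
    show "\<forall>\<^sub>F n in sequentially. norm (of_real (s n) * (1 - cis (- t n)) - \<i> * of_real u) \<le> u\<^sup>2 / 2 * (1 / s n)"
    proof (rule always_eventually, rule allI)
      fix n
      have "of_real (s n) * (1 - cis (- t n)) - \<i> * of_real u =
          - (of_real (s n) * (cis (- t n) - 1 - \<i> * of_real (- t n)))"
        by (simp add: algebra_simps flip: st[of n])
      then have "norm (of_real (s n) * (1 - cis (- t n)) - \<i> * of_real u) \<le> s n * ((- t n)\<^sup>2 / 2)"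
        using norm_cis_taylor_le(2)[of "- t n"] s(1)[of n]
        by (simp only: norm_minus_cancel norm_mult norm_of_real abs_of_pos mult_le_cancel_left_pos)
      also have "\<dots> = u\<^sup>2 / 2 * (1 / s n)"
        using s(1)[of n] by (simp add: t_def power2_eq_square)
      finally show "norm (of_real (s n) * (1 - cis (- t n)) - \<i> * of_real u) \<le> u\<^sup>2 / 2 * (1 / s n)" .
    qed
    show "(\<lambda>n. u\<^sup>2 / 2 * (1 / s n)) \<longlonglongrightarrow> 0"
      using tendsto_mult[OF tendsto_const inv_s, of "u\<^sup>2 / 2"] by simp
  qed

  define z where "z n = log_gf (A n) (t n) - log_gf (A n) 0 - \<i> * of_real (t n * moment 1 (A n))" for n
  \<comment> \<open>The cubic error is squared to stay with integer powers: x^(-8) from the third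
    moment meets (e^4 x^3)^3 from 1/s^6, leaving e^12 x.\<close>
  define K where "K = (moment_const 3 * \<bar>u\<bar> ^ 3 / 6)\<^sup>2 * exp 12"
  have z: "z \<longlonglongrightarrow> of_real (- u\<^sup>2 / 2)"
  proof (rule LIM_zero_cancel, rule Lim_null_comparison)
    show "\<forall>\<^sub>F n in sequentially. norm (z n - of_real (- u\<^sup>2 / 2)) \<le> sqrt (K * A n)"
    proof (rule always_eventually, rule allI)
      fix n
      have "t n ^ 2 * moment 2 (A n) = u\<^sup>2"
        unfolding s(2)[symmetric] by (simp flip: power_mult_distrib st[of n] add: mult.commute)
      then have "norm (z n - of_real (- u\<^sup>2 / 2)) \<le> moment 3 (A n) * \<bar>t n\<bar> ^ 3 / 6"
        using norm_log_gf_taylor_le[OF A(1)[of n], of "t n"] by (simp add: z_def)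
      also have "\<dots> \<le> moment_const 3 / A n ^ 4 * \<bar>t n\<bar> ^ 3 / 6"
        using moment_le[OF A(1)[of n], of 3] by (intro divide_right_mono mult_right_mono) (auto simp: eval_nat_numeral)
      finally have "norm (z n - of_real (- u\<^sup>2 / 2)) \<le> moment_const 3 / A n ^ 4 * \<bar>t n\<bar> ^ 3 / 6" .
      then have "(norm (z n - of_real (- u\<^sup>2 / 2)))\<^sup>2 \<le> (moment_const 3 / A n ^ 4 * \<bar>t n\<bar> ^ 3 / 6)\<^sup>2"
        by (intro power_mono) auto
      also have "\<dots> = (moment_const 3 * \<bar>u\<bar> ^ 3 / 6)\<^sup>2 / A n ^ 8 * (1 / (s n)\<^sup>2) ^ 3"
        using s(1)[of n] by (simp add: t_def abs_divide power_divide power_mult_distrib flip: power_mult)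
      also have "\<dots> \<le> (moment_const 3 * \<bar>u\<bar> ^ 3 / 6)\<^sup>2 / A n ^ 8 * (exp 4 * A n ^ 3) ^ 3"
        using s(3)[of n] A(1)[of n] by (intro mult_left_mono power_mono) auto
      also have "(exp 4 * A n ^ 3) ^ 3 = exp 4 ^ 3 * (A n ^ 8 * A n)"
        unfolding power_mult_distrib by (simp flip: power_mult power_Suc2)
      also have "exp 4 ^ 3 = exp (12::real)" by (simp flip: exp_of_nat_mult)
      also have "(moment_const 3 * \<bar>u\<bar> ^ 3 / 6)\<^sup>2 / A n ^ 8 * (exp 12 * (A n ^ 8 * A n)) = K * A n"
        using A(1)[of n] by (simp add: K_def)
      finally show "norm (z n - of_real (- u\<^sup>2 / 2)) \<le> sqrt (K * A n)"
        by (rule real_le_rsqrt)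
    qed
    have "(\<lambda>n. sqrt (K * A n)) \<longlonglongrightarrow> sqrt (K * 0)"
      by (intro tendsto_real_sqrt tendsto_mult tendsto_const A(3))
    then show "(\<lambda>n. sqrt (K * A n)) \<longlonglongrightarrow> 0" by simp
  qed

  have "(\<lambda>n. exp (z n) * (of_real (s n) * (1 - cis (- t n)) + of_real y * cis (- t n)) ^ d)
      \<longlonglongrightarrow> exp (of_real (- u\<^sup>2 / 2)) * (\<i> * of_real u + of_real y * 1) ^ d"
    by (intro tendsto_intros z linear cis_t)
  also have "exp (of_real (- u\<^sup>2 / 2)) * (\<i> * of_real u + of_real y * 1) ^ d =
      exp (- u\<^sup>2 / 2) *\<^sub>R (of_real y + \<i> * of_real u) ^ d"
    by (simp add: scaleR_conv_of_real add.commute flip: exp_of_real)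
  finally have lim: "(\<lambda>n. exp (z n) * (of_real (s n) * (1 - cis (- t n)) + of_real y * cis (- t n)) ^ d)
      \<longlonglongrightarrow> exp (- u\<^sup>2 / 2) *\<^sub>R (of_real y + \<i> * of_real u) ^ d" .
  \<comment> \<open>Since t tends to 0, the cutoff in \<open>kernel\<close> is eventually inactive
    at any fixed u.\<close>
  have "\<forall>\<^sub>F n in sequentially. \<bar>t n\<bar> < pi"
    using tendstoD[OF t0, of pi] by simp
  then have "\<forall>\<^sub>F n in sequentially. exp (z n) * (of_real (s n) * (1 - cis (- t n)) + of_real y * cis (- t n)) ^ d
      = kernel (A n) n d y u"
    using saddle
  proof eventually_elim
    case (elim n)
    have "exp (z n) = exp (log_gf (A n) (t n) - log_gf (A n) 0) * cis (- t n) ^ n"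
      unfolding z_def exp_diff[of _ "\<i> * _"] elim(2) Complex.DeMoivre
      by (simp add: cis_conv_exp exp_minus divide_inverse mult.commute)
    moreover have "- pi \<le> t n" "t n \<le> pi" using elim(1) by linarith+
    ultimately show ?case by (simp add: kernel_def integrand_def t_def s_def)
  qed
  with lim show ?thesis by (rule Lim_transform_eventually)
qed

section \<open>The limit of the scaled Jensen sums\<close>

lemma hermite_limit:
  assumes A: "\<And>n. 0 < A n" "\<And>n. A n \<le> 1" "A \<longlonglongrightarrow> 0"
    and saddle: "\<forall>\<^sub>F n in sequentially. moment 1 (A n) = real n"
  shows "(\<lambda>n. sdev (A n) ^ Suc d * (\<Sum>j\<le>d. real (d choose j) * (y / sdev (A n) - 1) ^ j * scaled_coeff (A n) n j))
    \<longlonglongrightarrow> sqrt (2 * pi) * poly (hermite d) y"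
proof -
  obtain C where C: "\<And>x n u. 0 < x \<Longrightarrow> x \<le> 1 \<Longrightarrow> norm (kernel x n d y u) \<le> C / (1 + u\<^sup>2)"
    using kernel_bound[where d = d and y = y] by blast
  have "(\<lambda>n. integral\<^sup>L lborel (kernel (A n) n d y)) \<longlonglongrightarrow>
      integral\<^sup>L lborel (\<lambda>u. exp (- u\<^sup>2 / 2) *\<^sub>R (of_real y + \<i> * of_real u) ^ d :: complex)"
  proof (rule integral_dominated_convergence)
    show "integrable lborel (\<lambda>u::real. C / (1 + u\<^sup>2))"
      by (rule integrable_inverse_one_plus_square)
    show "(\<lambda>u. exp (- u\<^sup>2 / 2) *\<^sub>R (of_real y + \<i> * of_real u) ^ d :: complex) \<in> borel_measurable lborel"
      by measurable
  qed (use A C kernel_tendsto[OF A saddle] measurable_kernel in auto)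
  then have "(\<lambda>n. complex_of_real (sdev (A n) ^ Suc d * (\<Sum>j\<le>d. real (d choose j) * (y / sdev (A n) - 1) ^ j * scaled_coeff (A n) n j)))
      \<longlonglongrightarrow> of_real (sqrt (2 * pi) * poly (hermite d) y)"
    by (simp only: integral_kernel[OF A(1,2)] has_bochner_integral_integral_eq[OF has_bochner_integral_hermite])
  then show ?thesis by (simp only: tendsto_of_real_iff)
qed

end

text \<open>Hides the analysis behind positive sequences. They do not depend on d or y, so several
  points y, or several orders d, can be treated at the same n.\<close>

lemma (in euler_product) hermite_scaling:
  obtains x s \<kappa> :: "nat \<Rightarrow> real" where "\<And>n. 0 < s n" "\<And>n. 0 < \<kappa> n"
    "\<And>d y. (\<lambda>n. s n ^ Suc d * (\<Sum>j\<le>d. real (d choose j) * (y / s n - 1) ^ j * (\<kappa> n * (a (n + j) * exp (- x n) ^ j))))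
      \<longlonglongrightarrow> sqrt (2 * pi) * poly (hermite d) y"
proof -
  obtain A where A: "\<And>n. 0 < A n" "\<And>n. A n \<le> 1" "A \<longlonglongrightarrow> 0"
    "\<forall>\<^sub>F n in sequentially. moment 1 (A n) = real n"
    using saddle_points by blast
  show thesis
  proof (rule that)
    show "0 < sdev (A n)" for n by (rule sdev_bounds[OF A(1,2)])
    show "0 < 2 * pi * exp (- real n * A n - moment 0 (A n))" for n by simp
    show "(\<lambda>n. sdev (A n) ^ Suc d * (\<Sum>j\<le>d. real (d choose j) * (y / sdev (A n) - 1) ^ j *
        (2 * pi * exp (- real n * A n - moment 0 (A n)) * (a (n + j) * exp (- A n) ^ j))))
      \<longlonglongrightarrow> sqrt (2 * pi) * poly (hermite d) y" for d y
      using hermite_limit[OF A] unfolding scaled_coeff_def .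
  qed
qed

section \<open>Jensen polynomials and Laguerre inequalities\<close>

text \<open>The scaled sum is a positive multiple of the Jensen polynomial at an increasing affine
  function of y, so the alternating Hermite points go to alternating points in the same
  order.\<close>

lemma eventually_jensen_poly_only_real_roots:
  assumes s: "\<And>n. 0 < s n" and \<kappa>: "\<And>n. 0 < \<kappa> n"
    and lim: "\<And>y. (\<lambda>n. s n ^ Suc d * (\<Sum>j\<le>d. real (d choose j) * (y / s n - 1) ^ j * (\<kappa> n * (Delta k (n + j) * exp (- x n) ^ j))))
      \<longlonglongrightarrow> sqrt (2 * pi) * poly (hermite d) y"
  shows "\<exists>N. \<forall>n\<ge>N. only_real_roots (jensen_poly k d n)"
proof -
  obtain p where p: "\<And>i. i < d \<Longrightarrow> p i < p (Suc i)"
    and sg: "\<And>i. i \<le> d \<Longrightarrow> 0 < (-1) ^ (d + i) * poly (hermite d) (p i)"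
    using hermite_alternating[of d] by blast
  define S where "S y n = s n ^ Suc d * (\<Sum>j\<le>d. real (d choose j) * (y / s n - 1) ^ j * (\<kappa> n * (Delta k (n + j) * exp (- x n) ^ j)))" for y n
  have "\<forall>\<^sub>F n in sequentially. 0 < (-1) ^ (d + i) * S (p i) n" if "i \<le> d" for i
  proof -
    have "(\<lambda>n. (-1) ^ (d + i) * S (p i) n) \<longlonglongrightarrow> (-1) ^ (d + i) * (sqrt (2 * pi) * poly (hermite d) (p i))"
      unfolding S_def by (intro tendsto_mult tendsto_const lim)
    moreover have "0 < (-1) ^ (d + i) * (sqrt (2 * pi) * poly (hermite d) (p i))"
      using mult_pos_pos[OF _ sg[OF that], of "sqrt (2 * pi)"] by (simp add: mult_ac)
    ultimately show ?thesis by (rule order_tendstoD(1))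
  qed
  then have "\<forall>\<^sub>F n in sequentially. \<forall>i\<in>{..d}. 0 < (-1) ^ (d + i) * S (p i) n"
    by (intro eventually_ball_finite) auto
  then obtain N where N: "\<And>n i. n \<ge> N \<Longrightarrow> i \<le> d \<Longrightarrow> 0 < (-1) ^ (d + i) * S (p i) n"
    unfolding eventually_sequentially by auto
  \<comment> \<open>The shift to \<open>Suc N\<close> accounts for \<open>jensen_poly\<close>
    starting at the coefficient n - 1.\<close>
  have "only_real_roots (jensen_poly k d n)" if "n \<ge> Suc N" for n
  proof -
    define m where "m = n - 1"
    have m: "m \<ge> N" using that by (simp add: m_def)
    define X where "X y = exp (- x m) * (y / s m - 1)" for y
    have "poly (jensen_poly k d n) v = (\<Sum>j\<le>d. real (d choose j) * Delta k (m + j) * v ^ j)" for v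
      by (simp add: jensen_poly_def m_def poly_sum poly_monom)
    then have poly: "S y m = s m ^ Suc d * \<kappa> m * poly (jensen_poly k d n) (X y)" for y
      by (simp add: S_def X_def sum_distrib_left power_mult_distrib mult_ac)
    show ?thesis
    proof (rule only_real_roots_if_alternating)
      show "degree (jensen_poly k d n) \<le> d"
        unfolding jensen_poly_def by (intro degree_sum_le order_trans[OF degree_monom_le]) auto
      show "X (p i) < X (p (Suc i))" if "i < d" for i
        using p[OF that] s[of m] by (simp add: X_def divide_strict_right_mono)
      show "0 < (-1) ^ (d + i) * poly (jensen_poly k d n) (X (p i))" if "i \<le> d" for i
      proof -
        have "0 < (s m ^ Suc d * \<kappa> m) * ((-1) ^ (d + i) * poly (jensen_poly k d n) (X (p i)))"
          using N[OF m that] by (simp add: poly mult_ac)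
        then show ?thesis
          by (rule zero_less_mult_pos) (use s \<kappa> in simp)
      qed
    qed
  qed
  then show ?thesis by blast
qed

text \<open>At 0 the odd Hermite values vanish and the one of index 2l has sign (-1)^l. The product
  for indices 2l and 2m - 2l thus has sign (-1)^m, which the prefactor cancels.\<close>

lemma eventually_L_op_nonneg:
  assumes s: "\<And>n. 0 < s n" and \<kappa>: "\<And>n. 0 < \<kappa> n"
    and lim: "\<And>d. (\<lambda>n. s n ^ Suc d * (\<Sum>j\<le>d. real (d choose j) * (-1) ^ j * (\<kappa> n * (Delta k (n + j) * exp (- x n) ^ j))))
      \<longlonglongrightarrow> sqrt (2 * pi) * poly (hermite d) 0"
  shows "\<exists>N. \<forall>n\<ge>N. 0 \<le> L_op k m n"
proof -
  define h where "h i = sqrt (2 * pi) * poly (hermite i) 0" for i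
  have h: "h i = sqrt (2 * pi) * gauss_moment i" for i
    by (simp add: h_def poly_0_coeff_0 coeff_hermite)
  define r where "r n j = \<kappa> n * (Delta k (n + j) * exp (- x n) ^ j)" for n j
  define D where "D n i = (\<Sum>j\<le>i. real (i choose j) * (-1) ^ j * r n j)" for n i
  define T where "T n = (-1) ^ m * (\<Sum>i\<le>2*m. (-1) ^ i * real ((2*m) choose i) * (s n ^ Suc i * D n i) * (s n ^ Suc (2*m - i) * D n (2*m - i)))" for n
  have D: "(\<lambda>n. s n ^ Suc i * D n i) \<longlonglongrightarrow> h i" for i
    using lim[of i] by (simp add: D_def r_def h_def)
  have "T \<longlonglongrightarrow> (-1) ^ m * (\<Sum>i\<le>2*m. (-1) ^ i * real ((2*m) choose i) * h i * h (2*m - i))"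
    unfolding T_def by (intro tendsto_intros D)
  moreover have "0 < (-1) ^ m * (\<Sum>i\<le>2*m. (-1) ^ i * real ((2*m) choose i) * h i * h (2*m - i))"
  proof -
    have nonneg: "0 \<le> (-1) ^ m * ((-1) ^ i * real ((2*m) choose i) * h i * h (2*m - i))" if "i \<le> 2 * m" for i
    proof (cases "even i")
      case True
      then obtain l where l: "i = 2 * l" by auto
      then obtain r where r: "m = l + r" using \<open>i \<le> 2 * m\<close> le_Suc_ex[of l m] by auto
      have i: "2 * m - i = 2 * r" "(-1::real) ^ i = 1" "(-1::real) ^ m = (-1) ^ l * (-1) ^ r"
        by (auto simp: l r power_add)
      have pos: "0 \<le> (-1) ^ j * gauss_moment (2 * j)" for j
        by (simp add: gauss_moment_even flip: mult.assoc power_mult_distrib)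
      have "(-1) ^ m * ((-1) ^ i * real ((2*m) choose i) * h i * h (2*m - i)) =
          real ((2*m) choose i) * (sqrt (2 * pi) * sqrt (2 * pi)) *
          ((-1) ^ l * gauss_moment (2 * l)) * ((-1) ^ r * gauss_moment (2 * r))"
        unfolding h i unfolding l by (simp only: mult_1_left mult_ac)
      also have "0 \<le> \<dots>" by (intro mult_nonneg_nonneg pos) auto
      finally show ?thesis .
    next
      case False
      then show ?thesis by (simp add: h gauss_moment_odd)
    qed
    \<comment> \<open>Strict positivity of the term i = 0 is what lets the sign of the limit pass to
      all large n.\<close>
    have "0 < (-1) ^ m * ((-1) ^ 0 * real ((2*m) choose 0) * h 0 * h (2*m - 0))"
      by (simp add: h gauss_moment_even mult.left_commute[of "(-1) ^ m"] flip: power_mult_distrib)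
    also have "\<dots> \<le> (\<Sum>i\<le>2*m. (-1) ^ m * ((-1) ^ i * real ((2*m) choose i) * h i * h (2*m - i)))"
      using nonneg by (intro member_le_sum) auto
    finally show ?thesis by (simp only: sum_distrib_left)
  qed
  ultimately have "\<forall>\<^sub>F n in sequentially. 0 < T n"
    by (rule order_tendstoD(1))
  moreover have "0 \<le> L_op k m n" if "0 < T n" for n
  proof -
    \<comment> \<open>The two indices add up to 2m in every term, so the scaling factors combine to
      a common positive constant.\<close>
    define c where "c = s n ^ (2*m + 2) * (\<kappa> n)\<^sup>2 * exp (- x n) ^ (2*m)"
    have c: "0 < c" using s[of n] \<kappa>[of n] by (simp add: c_def)
    have "(\<Sum>i\<le>2*m. (-1) ^ i * real ((2*m) choose i) * (s n ^ Suc i * D n i) * (s n ^ Suc (2*m - i) * D n (2*m - i)))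
        = (\<Sum>i\<le>2*m. s n ^ (2*m + 2) * ((-1) ^ i * real ((2*m) choose i) * D n i * D n (2*m - i)))"
    proof (intro sum.cong refl)
      fix i assume "i \<in> {..2*m}"
      then have pw: "s n ^ Suc i * s n ^ Suc (2*m - i) = s n ^ (2*m + 2)"
        unfolding power_add[symmetric] by (intro arg_cong2[of _ _ _ _ power]) auto
      show "(-1) ^ i * real ((2*m) choose i) * (s n ^ Suc i * D n i) * (s n ^ Suc (2*m - i) * D n (2*m - i))
          = s n ^ (2*m + 2) * ((-1) ^ i * real ((2*m) choose i) * D n i * D n (2*m - i))"
        unfolding pw[symmetric] by (simp only: mult_ac)
    qed
    then have "T n = (-1) ^ m * s n ^ (2*m + 2) * (\<Sum>i\<le>2*m. (-1) ^ i * real ((2*m) choose i) * D n i * D n (2*m - i))"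
      by (simp only: T_def sum_distrib_left mult.assoc)
    also have "\<dots> = (-1) ^ m * s n ^ (2*m + 2) * (\<Sum>i\<le>2*m. (-1) ^ i * real ((2*m) choose i) * r n i * r n (2*m - i))"
      unfolding D_def binomial_convolution_difference ..
    also have "\<dots> = 2 * c * L_op k m n"
      unfolding L_op_def sum_distrib_left
    proof (intro sum.cong refl)
      fix i assume "i \<in> {..2*m}"
      then have i: "i \<le> 2 * m" by simp
      then have pw: "exp (- x n) ^ (2*m) = exp (- x n) ^ i * exp (- x n) ^ (2*m - i)"
        unfolding power_add[symmetric] by simp
      have "n + 2*m - i = n + (2*m - i)" using i by simp
      then show "(-1) ^ m * s n ^ (2*m + 2) * ((-1) ^ i * real ((2*m) choose i) * r n i * r n (2*m - i)) =
          2 * c * (1 / 2 * ((-1) ^ (i + m) * real ((2*m) choose i) * Delta k (n + i) * Delta k (n + 2*m - i)))"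
        unfolding r_def c_def pw power_add[of "-1"] power2_eq_square by (simp add: mult_ac)
    qed
    finally have "0 < c * L_op k m n" using that by simp
    then show ?thesis using c by (simp add: zero_less_mult_iff)
  qed
  ultimately show ?thesis unfolding eventually_sequentially by blast
qed

theorem theorem1p3:
  fixes k :: nat
  assumes "k \<ge> 1"
  shows "(\<forall>d::nat. d \<ge> 1 \<longrightarrow> (\<exists>N. \<forall>n\<ge>N. only_real_roots (jensen_poly k d n)))
       \<and> (\<forall>m::nat. m \<ge> 1 \<longrightarrow> (\<exists>N. \<forall>n\<ge>N. L_op k m n \<ge> 0))"
proof -
  interpret euler_product "Delta_weight k" 3 "Delta k"
    by unfold_locales (rule Delta_weight_bounds Delta_0 Delta_log_deriv)+
  obtain x s \<kappa> :: "nat \<Rightarrow> real" where s: "\<And>n. 0 < s n" and \<kappa>: "\<And>n. 0 < \<kappa> n"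
    and lim: "\<And>d y. (\<lambda>n. s n ^ Suc d * (\<Sum>j\<le>d. real (d choose j) * (y / s n - 1) ^ j * (\<kappa> n * (Delta k (n + j) * exp (- x n) ^ j))))
      \<longlonglongrightarrow> sqrt (2 * pi) * poly (hermite d) y"
    by (rule hermite_scaling) (rule that)
  have "\<exists>N. \<forall>n\<ge>N. only_real_roots (jensen_poly k d n)" for d
    by (rule eventually_jensen_poly_only_real_roots[OF s \<kappa> lim])
  moreover have "\<exists>N. \<forall>n\<ge>N. 0 \<le> L_op k m n" for m
    \<comment> \<open>At y = 0 the weights (y/s - 1)^j become (-1)^j, so the sums are finite
      differences.\<close>
    by (rule eventually_L_op_nonneg[OF s \<kappa>]) (use lim[where y = 0] in simp)
  ultimately show ?thesis by blast
qed

end
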